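(* Let $g$ be a regularly varying function, $q\in[0,1)$, and let $\Phi_q:[0,1)\to[0,\infty)$ be given by $\Phi_q(0):=0$ and $\Phi_q(x):=x^{\frac1{1-q}}g\big(\frac{-\log_2x}{1-q}\big)^{-\frac1{2(1-q)}}$ for $0<x<1$. For each $m\in\mathbb N_0$ let $\sigma_m:[0,1]\to\{-1,+1\}$ be any function that is constant on each interval $[(k-1)2^{-m},k2^{-m})$, $k=1,\dots,2^m$. For a sequence $\{\alpha_m\}_{m\in\mathbb N_0}$ consider the functions $$f(t)=\sum_{m=0}^\infty\alpha_m\varphi(2^mt)\qquad\text{and}\qquad f(t)=\sum_{m=0}^\infty\alpha_m\sigma_m(t)\varphi(2^mt),\qquad t\in[0,1].\tag{$*$}$$ (a) For $q\in(0,1)$, the functions $f$ in $( * )$ with coefficients $$\alpha_m:=2^{-m(1-q)}\sqrt{(2^{2q}-1)g(m)}$$ have the linear $\Phi_q$-variation $\langle f\rangle_t^{\Phi_q}=\mathbb E\big[|Z|^{\frac1{1-q}}\big]\cdot t$ for all $t\in[0,1]$, where $Z:=\sqrt{2^{2q}-1}\sum_{m=1}^\infty2^{-qm}Y_m$ and $\{Y_m\}_{m\in\mathbb N}$ is an i.i.d. sequence of symmetric $\{-1,+1\}$-valued Bernoulli random variables. (b) For $q=0$, assume in addition that $g(x)\to\infty$ as $x\uparrow\infty$ and that $g$ is absolutely continuous with regularly varying derivative $g'$. Then the functions $f$ in $( * )$ with coefficients $$\alpha_m:=2^{-m}\sqrt{g'(m)}$$ have the linear $\Phi_0$-variation $\langle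 f\rangle_t^{\Phi_0}=\sqrt{\tfrac2\pi}\cdot t$ for all $t\in[0,1]$.
   Context: $\varphi(t):=\min_{z\in\mathbb Z}|z-t|$ is the tent map. A measurable, strictly positive function $g:[0,\infty)\to(0,\infty)$ is called regularly varying (at infinity) with index $\varrho\in\mathbb R$ if $g(\lambda x)/g(x)\to\lambda^\varrho$ as $x\uparrow\infty$ for every $\lambda>0$. All regularly varying functions (including $g'$) are assumed to be defined on $[0,\infty)$ and bounded on compact intervals. Absolute continuity of $g$ with derivative $g'$ means $g(x)=g(0)+\int_0^xg'(t)\,dt$ for all $x\ge0$. For a function $\Phi\ge0$ with $\Phi(0)=0$, the $\Phi$-variation of a continuous function $f:[0,1]\to\mathbb R$ along the dyadic partitions is $$\langle f\rangle^\Phi_t:=\lim_{n\uparrow\infty}\sum_{k=0}^{\lfloor t2^n\rfloor}\Phi\big(|f((k+1)2^{-n})-f(k2^{-n})|\big),\qquad 0\le t\le1,$$ provided the limit exists for all $t\in[0,1]$ (a claimed formula includes existence of the limit); for $t=1$ the term $k=2^n$ is omitted, and only $n$ large enough that all increments have absolute value less than $1$ are considered, so that $\Phi$ need only be defined on $[0,1)$. A symmetric $\{-1,+1\}$-valued Bernoulli random variable takes each value with probability $\tfrac12$. *)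

theory Defs
  imports "HOL-Probability.Probability"
begin

text \<open>The infimum is attained, at an integer nearest to \<open>t\<close>.\<close>
definition tent :: "real \<Rightarrow> real" where
  "tent t = (INF z::int. \<bar>of_int z - t\<bar>)"

text \<open>Functions on \<open>[0,\<infinity>)\<close> are modelled by total functions on the reals, whose values on the
  negative half-line are unconstrained. Measurability is Lebesgue measurability, the weakest
  reading; it covers Borel functions. Local boundedness is part of the notion.\<close>
definition regularly_varying :: "(real \<Rightarrow> real) \<Rightarrow> real \<Rightarrow> bool" where
  "regularly_varying g \<rho> \<longleftrightarrow>
     g \<in> borel_measurable (lebesgue_on {0..}) \<and>
     (\<forall>x\<ge>0. 0 < g x) \<and>
     (\<forall>a b. 0 \<le> a \<longrightarrow> bounded (g ` {a..b})) \<and>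
     (\<forall>l>0. ((\<lambda>x. g (l * x) / g x) \<longlongrightarrow> l powr \<rho>) at_top)"

text \<open>Only arguments in \<open>[0,1)\<close> are meaningful: for \<open>x \<ge> 1\<close> the formula evaluates \<open>g\<close> at
  nonpositive points.\<close>
definition Phi :: "(real \<Rightarrow> real) \<Rightarrow> real \<Rightarrow> real \<Rightarrow> real" where
  "Phi g q x =
     (if x = 0 then 0
      else x powr (1 / (1 - q)) * g (- log 2 x / (1 - q)) powr (- (1 / (2 * (1 - q)))))"

text \<open>\<open>V t\<close> is the \<open>\<Phi>\<close>-variation of the continuous function \<open>f\<close> on \<open>[0,t]\<close> along the dyadic
  partitions, existence of the limits included. Since \<open>f\<close> is uniformly continuous on \<open>[0,1]\<close>, all
  increments are below 1 for all large \<open>n\<close>, so the limit does not depend on the values of \<open>\<Phi>\<close>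
  outside \<open>[0,1)\<close>. Removing the index \<open>2^n\<close> only has an effect for \<open>t = 1\<close>.\<close>
definition has_dyadic_variation ::
    "(real \<Rightarrow> real) \<Rightarrow> (real \<Rightarrow> real) \<Rightarrow> (real \<Rightarrow> real) \<Rightarrow> bool" where
  "has_dyadic_variation \<Phi> f V \<longleftrightarrow>
     continuous_on {0..1} f \<and>
     (\<forall>t\<in>{0..1}.
        (\<lambda>n. \<Sum>k\<in>{..nat \<lfloor>t * 2 ^ n\<rfloor>} - {2 ^ n}.
               \<Phi> \<bar>f ((real k + 1) / 2 ^ n) - f (real k / 2 ^ n)\<bar>) \<longlonglongrightarrow> V t)"

definition dyadic_sign :: "nat \<Rightarrow> (real \<Rightarrow> real) \<Rightarrow> bool" where
  "dyadic_sign m s \<longleftrightarrow>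
     (\<forall>t\<in>{0..1}. s t \<in> {-1, 1}) \<and>
     (\<forall>k\<in>{1..2 ^ m :: nat}. s constant_on {(real k - 1) / 2 ^ m ..< real k / 2 ^ m})"

definition tent_series :: "(nat \<Rightarrow> real) \<Rightarrow> real \<Rightarrow> real" where
  "tent_series \<alpha> t = (\<Sum>m. \<alpha> m * tent (2 ^ m * t))"

definition signed_tent_series ::
    "(nat \<Rightarrow> real) \<Rightarrow> (nat \<Rightarrow> real \<Rightarrow> real) \<Rightarrow> real \<Rightarrow> real" where
  "signed_tent_series \<alpha> \<sigma> t = (\<Sum>m. \<alpha> m * \<sigma> m t * tent (2 ^ m * t))"

definition symmetric_bernoulli :: "'a measure \<Rightarrow> ('a \<Rightarrow> real) \<Rightarrow> bool" where
  "symmetric_bernoulli M X \<longleftrightarrow>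
     X \<in> borel_measurable M \<and>
     (\<forall>\<omega>\<in>space M. X \<omega> \<in> {-1, 1}) \<and>
     measure M {\<omega> \<in> space M. X \<omega> = 1} = 1 / 2 \<and>
     measure M {\<omega> \<in> space M. X \<omega> = -1} = 1 / 2"

text \<open>The series over \<open>m = 1, 2, \<dots>\<close>, shifted to start at 0.\<close>
definition Z_var :: "real \<Rightarrow> (nat \<Rightarrow> 'a \<Rightarrow> real) \<Rightarrow> 'a \<Rightarrow> real" where
  "Z_var q Y \<omega> =
     sqrt (2 powr (2 * q) - 1) * (\<Sum>m. 2 powr (- (q * real (Suc m))) * Y (Suc m) \<omega>)"

definition coeff_a :: "(real \<Rightarrow> real) \<Rightarrow> real \<Rightarrow> nat \<Rightarrow> real" where
  "coeff_a g q m = 2 powr (- (real m * (1 - q))) * sqrt ((2 powr (2 * q) - 1) * g (real m))"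

definition coeff_b :: "(real \<Rightarrow> real) \<Rightarrow> nat \<Rightarrow> real" where
  "coeff_b g' m = 2 powr (- real m) * sqrt (g' (real m))"

end

theory Submission imports Defs "HOL-Real_Asymp.Real_Asymp" begin

text \<open>Write \<open>b m = 2^m \<alpha> m\<close>. Since \<open>\<phi> (2^m t)\<close> is affine on dyadic intervals of level \<open>n > m\<close> and
  vanishes at the dyadic points of level \<open>n \<le> m\<close>, halving a dyadic interval of level \<open>n\<close> replaces
  the slope \<open>D\<close> of \<open>f\<close> over it by the two slopes \<open>D + b n\<close> and \<open>D - b n\<close>, in an order that depends
  on \<open>\<sigma> n\<close>. So over the level-\<open>n\<close> descendants of a fixed dyadic interval the slopes are distributed
  like a constant plus \<open>\<plusminus> b N \<plusminus> \<dots> \<plusminus> b (n - 1)\<close> with independent fair signs, whatever \<open>\<sigma>\<close> is.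
  By Potter's bounds for \<open>g\<close>, the normalised summand \<open>2^n \<Phi>\<close> at a slope \<open>D\<close> is \<open>w powr p\<close> up to an
  error \<open>\<epsilon> (1 + w powr (2 p))\<close>, where \<open>p = 1 / (1 - q)\<close> and \<open>w = \<bar>D\<bar> / (2 powr (n q) * sqrt (g n))\<close>. If \<open>q > 0\<close>,
  reading the signs backwards turns \<open>w\<close> into a series converging pointwise to \<open>\<bar>Z\<bar>\<close>; if \<open>q = 0\<close>, a central
  limit theorem applies because \<open>g' 0 + \<dots> + g' (n - 1) \<sim> g n\<close> and each single summand is negligible.\<close>

section \<open>Regularly varying functions\<close>

text \<open>An increment of size \<open>2 powr (- (n * (1 - q))) * sqrt (g n) * w\<close> makes
  \<open>Phi\<close> evaluate \<open>g\<close> at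
  \<open>n - p / 2 * log 2 (g n) - p * log 2 w\<close>, a point near \<open>n\<close>; there the
  power of \<open>g\<close> in \<open>Phi\<close> cancels the factor \<open>sqrt (g n)\<close>. The
  obstacle is that this must hold for all increments at once: a tiny \<open>w\<close> pushes the
  point far above \<open>n\<close>, a large one pulls it below. Convergence of
  \<open>g (l * x) / g x\<close> for each fixed \<open>l\<close> is too weak for that, hence the
  uniform bounds. They leave a factor \<open>exp s\<close> with \<open>s\<close> small against
  \<open>1 + \<bar>ln w\<bar>\<close>, and the logarithm is absorbed by
  \<open>1 + w powr (2 * p)\<close>, whose mean stays bounded. For large \<open>w\<close> the crude
  bound \<open>2 * n\<close> is enough, since only \<open>log 2 w = o(n)\<close> matters. Blocks may
  start from any slope because linearity in \<open>t\<close> asks for the same limit over every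
  dyadic interval; the start is forgotten as the normalising factor tends to infinity. The constant
  \<open>2 powr (2 * q) - 1\<close> is the reciprocal of the sum of
  \<open>2 powr (- (2 * q * m))\<close> over \<open>m \<ge> 1\<close>, so that \<open>Z\<close> has
  variance 1, and \<open>sqrt (2 / pi)\<close> is the first absolute moment of the standard normal
  law.\<close>

lemma slowly_varying_uniform:
  fixes H :: "real \<Rightarrow> real"
  assumes H: "H \<in> borel_measurable lebesgue"
    and lim: "\<And>l. l > 0 \<Longrightarrow> ((\<lambda>x. H (l * x) - H x) \<longlongrightarrow> 0) at_top"
    and e: "e > 0"
  shows "\<exists>x0>0. \<forall>x\<ge>x0. \<forall>c\<in>{1..2}. \<bar>H (c * x) - H x\<bar> < e"
proof -
  \<comment> \<open>The classical measure argument for the uniform convergence theorem: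
    \<open>D x\<close> collects the bad factors and \<open>E x\<close> the bad points, which is
    \<open>D x\<close> scaled by \<open>x\<close>. Pointwise convergence makes the measure of
    \<open>D x\<close> tend to 0, so \<open>E x\<close> eventually has measure below
    \<open>x / 2\<close>.\<close>
  define D where "D x = {u\<in>{1..4}. e / 2 \<le> \<bar>H (x * u) - H x\<bar>}" for x
  define E where "E x = {t\<in>{x..4*x}. e / 2 \<le> \<bar>H t - H x\<bar>}" for x
  have Em: "E x \<in> lmeasurable" for x
  proof -
    have [measurable]: "{x..4*x} \<in> sets lebesgue" by auto
    have "{t\<in>space lebesgue. t \<in> {x..4*x} \<and> e / 2 \<le> \<bar>H t - H x\<bar>} \<in> sets lebesgue"
      using H by measurable
    then have "E x \<in> sets lebesgue" by (simp add: E_def)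
    moreover have "E x \<subseteq> cbox x (4*x)" by (auto simp: E_def)
    ultimately show ?thesis
      using bounded_set_imp_lmeasurable bounded_cbox bounded_subset by blast
  qed
  have DE: "D x = (\<lambda>u. 0 + (1 / x) *\<^sub>R u) ` E x" if "x > 0" for x
  proof (intro set_eqI iffI)
    fix u assume "u \<in> D x"
    then have "x * u \<in> E x" "u = 0 + (1/x) *\<^sub>R (x * u)"
      using that by (auto simp: D_def E_def)
    then show "u \<in> (\<lambda>u. 0 + (1 / x) *\<^sub>R u) ` E x" by blast
  qed (use that in \<open>auto simp: D_def E_def field_simps\<close>)
  have mDE: "measure lebesgue (D x) = measure lebesgue (E x) / x" if "x > 0" for x
    using measure_lebesgue_affine[of "1/x" 0 "E x"] that by (simp add: DE)
  have Dm: "D x \<in> lmeasurable" if "x > 0" for x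
  proof -
    have "(*\<^sub>R) x -` E x \<inter> space lebesgue \<in> sets lebesgue"
      by (rule measurable_sets[OF lebesgue_measurable_scaling fmeasurableD[OF Em]])
    moreover have "(*\<^sub>R) x -` E x \<inter> space lebesgue = D x"
      using that by (auto simp: D_def E_def)
    ultimately have "D x \<in> sets lebesgue" by simp
    moreover have "D x \<subseteq> cbox 1 4" by (auto simp: D_def)
    ultimately show ?thesis
      using bounded_set_imp_lmeasurable bounded_cbox bounded_subset by blast
  qed
  \<comment> \<open>Dominated convergence asks for measurability at every \<open>x\<close>, while
    \<open>Dm\<close> covers positive arguments; \<open>max 1 x\<close> bridges the gap.\<close>
  have "((\<lambda>x. LINT u|lebesgue. indicator (D (max 1 x)) u :: real) \<longlongrightarrow> (LINT u::real|lebesgue. 0)) at_top"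
  proof (rule integral_dominated_convergence_at_top[where w = "indicator {1..4}"])
    show "integrable lebesgue (indicator {1..4::real} :: real \<Rightarrow> real)"
      by (simp add: integrable_indicator_iff)
    show "AE u in lebesgue. ((\<lambda>x. indicator (D (max 1 x)) u :: real) \<longlongrightarrow> 0) at_top"
    proof (rule AE_I2, rule tendsto_eventually)
      fix u :: real
      show "\<forall>\<^sub>F x in at_top. indicator (D (max 1 x)) u = (0::real)"
      proof (cases "u \<in> {1..4}")
        case True
        then have "\<forall>\<^sub>F x in at_top. dist (H (u * x) - H x) 0 < e / 2"
          using tendstoD[OF lim[of u], of "e/2"] e by auto
        then show ?thesis using eventually_ge_at_top[of 1]
          by eventually_elim (auto simp: D_def mult.commute)
      qed (auto simp: D_def)
    qed
    show "\<forall>\<^sub>F x in at_top. AE u in lebesgue. norm (indicator (D (max 1 x)) u :: real) \<le> indicator {1..4} u"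
      by (intro always_eventually allI AE_I2) (auto simp: D_def indicator_def)
  qed (use Dm in \<open>auto intro!: borel_measurable_indicator fmeasurableD\<close>)
  moreover have "(LINT u|lebesgue. indicator (D (max 1 x)) u :: real) = measure lebesgue (D (max 1 x))" for x
    using Dm[of "max 1 x"] by simp
  ultimately have "((\<lambda>x. measure lebesgue (D (max 1 x))) \<longlongrightarrow> 0) at_top" by simp
  from order_tendstoD(2)[OF this, of "1/2"]
  have "\<forall>\<^sub>F x in at_top. measure lebesgue (D (max 1 x)) < 1/2" by simp
  then obtain x1 where x1: "\<And>x. x \<ge> x1 \<Longrightarrow> measure lebesgue (D (max 1 x)) < 1/2"
    by (auto simp: eventually_at_top_linorder)
  define x0 where "x0 = max 1 x1"
  have small: "measure lebesgue (E x) < x / 2" if "x \<ge> x0" for x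
  proof -
    have x: "x \<ge> 1" "x \<ge> x1" using that by (auto simp: x0_def)
    then have "measure lebesgue (E x) / x < 1/2"
      using x1[of x] mDE[of x] by (simp add: max_def split: if_splits)
    then show ?thesis using x by (simp add: field_simps)
  qed
  show ?thesis
  proof (intro exI[of _ x0] conjI allI impI ballI)
    show "x0 > 0" by (simp add: x0_def)
    fix x c :: real assume x: "x \<ge> x0" and c: "c \<in> {1..2}"
    have x': "x > 0" "x \<le> c * x" "c * x \<le> 2 * x" using x c by (auto simp: x0_def)
    \<comment> \<open>\<open>E x\<close> and \<open>E (c * x)\<close> are too small to cover \<open>{c*x..4*x}\<close>, so that \<open>H x\<close> and \<open>H (c * x)\<close>
      can be compared through a common point.\<close>
    have "\<exists>t\<in>{c*x..4*x}. t \<notin> E x \<and> t \<notin> E (c * x)"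
    proof (rule ccontr)
      assume "\<not> ?thesis"
      then have sub: "{c*x..4*x} \<subseteq> E x \<union> E (c*x)" by auto
      have "4*x - c*x = measure lebesgue {c*x..4*x}" using x' by simp
      also have "\<dots> \<le> measure lebesgue (E x \<union> E (c*x))"
        by (rule measure_mono_fmeasurable[OF sub]) (auto intro: fmeasurable.Un Em)
      also have "\<dots> \<le> measure lebesgue (E x) + measure lebesgue (E (c*x))"
        using Em by (intro measure_Un_le) auto
      also have "\<dots> < x/2 + c*x/2"
        using small[of x] small[of "c*x"] x x' by (intro add_strict_mono) auto
      finally show False using x' by linarith
    qed
    then obtain t where t: "t \<in> {c*x..4*x}" "t \<notin> E x" "t \<notin> E (c*x)" by blast
    then have "\<bar>H t - H x\<bar> < e/2" "\<bar>H t - H (c*x)\<bar> < e/2"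
      using x' by (auto simp: E_def)
    then show "\<bar>H (c * x) - H x\<bar> < e" by linarith
  qed
qed

text \<open>Going from \<open>x\<close> to \<open>y\<close> takes at most
  \<open>log 2 (y / x)\<close> doublings, each costing at most \<open>e\<close>; the summand 1 pays
  for the remaining factor in \<open>{1..2}\<close>.\<close>

lemma slowly_varying_potter:
  fixes H :: "real \<Rightarrow> real"
  assumes "H \<in> borel_measurable lebesgue"
    and "\<And>l. l > 0 \<Longrightarrow> ((\<lambda>x. H (l * x) - H x) \<longlongrightarrow> 0) at_top"
    and "e > 0"
  shows "\<exists>x0>0. \<forall>x\<ge>x0. \<forall>y\<ge>x. \<bar>H y - H x\<bar> \<le> e * (1 + log 2 (y / x))"
proof -
  obtain x0 where x0: "x0 > 0" and *: "\<And>x c. x \<ge> x0 \<Longrightarrow> c \<in> {1..2} \<Longrightarrow> \<bar>H (c * x) - H x\<bar> < e"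
    using slowly_varying_uniform[OF assms] by blast
  have iter: "\<bar>H (2 ^ n * x) - H x\<bar> \<le> e * real n" if "x \<ge> x0" for n x
  proof (induction n)
    case (Suc n)
    have "x \<le> 2 ^ n * x" using that x0 by simp
    then have "\<bar>H (2 * (2 ^ n * x)) - H (2 ^ n * x)\<bar> < e"
      using that by (intro *) auto
    with Suc show ?case by (simp add: algebra_simps)
  qed simp
  show ?thesis
  proof (intro exI[of _ x0] conjI allI impI x0)
    fix x y assume xy: "x \<ge> x0" "y \<ge> (x::real)"
    define n where "n = nat \<lfloor>log 2 (y / x)\<rfloor>"
    have ge1: "y / x \<ge> 1" using xy x0 by simp
    then have l0: "log 2 (y/x) \<ge> 0" by simp
    then have n: "real n \<le> log 2 (y/x)" "log 2 (y/x) < real n + 1"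
      unfolding n_def by linarith+
    define c where "c = y / (2 ^ n * x)"
    have yc: "y = c * (2 ^ n * x)" using xy x0 by (simp add: c_def)
    have "2 powr real n \<le> y / x"
      using n(1) ge1 by (subst (asm) le_log_iff) auto
    moreover have "y / x \<le> 2 powr (real n + 1)"
      using less_imp_le[OF n(2)] ge1 by (subst (asm) log_le_iff) auto
    ultimately have "2 powr real n \<le> y / x" "y / x \<le> 2 powr (real n + 1)" by auto
    then have c: "c \<in> {1..2}" using xy x0
      by (auto simp: c_def field_simps powr_add powr_realpow)
    have "x \<le> 2 ^ n * x" using xy x0 by simp
    then have "\<bar>H y - H (2 ^ n * x)\<bar> < e" unfolding yc using xy by (intro * c) auto
    with iter[of x n] xy have "\<bar>H y - H x\<bar> \<le> e * (1 + real n)" by (simp add: algebra_simps)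
    also have "\<dots> \<le> e * (1 + log 2 (y / x))" using n \<open>e > 0\<close> by simp
    finally show "\<bar>H y - H x\<bar> \<le> e * (1 + log 2 (y / x))" .
  qed
qed

lemma regularly_varying_potter:
  assumes g: "regularly_varying g \<rho>" and "e > 0"
  shows "\<exists>x0>0. \<forall>x\<ge>x0. \<forall>y\<ge>x.
    \<bar>ln (g y) - ln (g x) - \<rho> * ln (y / x)\<bar> \<le> e * (1 + log 2 (y / x))"
proof -
  \<comment> \<open>Dividing \<open>g\<close> by its power of \<open>t\<close> leaves a slowly
    varying function. Only the half-line is under control, so the logarithm is extended by 0 to be
    measurable on the whole line.\<close>
  define H where "H t = (if t \<in> {0..} then ln (g t) - \<rho> * ln t else 0)" for t
  have [measurable]: "g \<in> borel_measurable (lebesgue_on {0..})"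
    using g by (simp add: regularly_varying_def)
  have "(\<lambda>t. ln (g t) - \<rho> * ln t) \<in> borel_measurable (lebesgue_on {0..})"
  proof -
    have [measurable]: "(\<lambda>t::real. t) \<in> borel_measurable (lebesgue_on {0..})"
      by (intro measurable_restrict_space1 measurable_completion) auto
    show ?thesis by measurable
  qed
  then have H: "H \<in> borel_measurable lebesgue"
    unfolding H_def by (subst (asm) borel_measurable_if[symmetric]) auto
  have pos: "g x > 0" if "x \<ge> 0" for x using g that by (simp add: regularly_varying_def)
  have "((\<lambda>x. H (l * x) - H x) \<longlongrightarrow> 0) at_top" if l: "l > 0" for l
  proof -
    have "((\<lambda>x. g (l * x) / g x) \<longlongrightarrow> l powr \<rho>) at_top"
      using g l by (simp add: regularly_varying_def)
    then have "((\<lambda>x. ln (g (l * x) / g x) - \<rho> * ln l) \<longlongrightarrow> ln (l powr \<rho>) - \<rho> * ln l) at_top"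
      using l by (intro tendsto_intros) auto
    then have "((\<lambda>x. ln (g (l * x) / g x) - \<rho> * ln l) \<longlongrightarrow> 0) at_top" using l by (simp add: ln_powr)
    then show ?thesis
    proof (rule Lim_transform_eventually)
      show "\<forall>\<^sub>F x in at_top. ln (g (l * x) / g x) - \<rho> * ln l = H (l * x) - H x"
        using eventually_gt_at_top[of 0]
      proof eventually_elim
        case (elim x)
        then have "g x > 0" "g (l * x) > 0" using l by (auto intro: pos)
        then show ?case using elim l by (simp add: H_def ln_div ln_mult algebra_simps)
      qed
    qed
  qed
  from slowly_varying_potter[OF H this \<open>e > 0\<close>]
  obtain x0 where x0: "x0 > 0" and *: "\<And>x y. x \<ge> x0 \<Longrightarrow> y \<ge> x \<Longrightarrow> \<bar>H y - H x\<bar> \<le> e * (1 + log 2 (y / x))"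
    by blast
  show ?thesis
  proof (intro exI[of _ x0] conjI x0 allI impI)
    fix x y assume "x \<ge> x0" "y \<ge> x"
    with *[of x y] x0 show "\<bar>ln (g y) - ln (g x) - \<rho> * ln (y / x)\<bar> \<le> e * (1 + log 2 (y / x))"
      by (simp add: H_def ln_div algebra_simps)
  qed
qed

text \<open>Since \<open>e \<le> 1\<close> and \<open>1 / ln 2 \<le> 2\<close>, the term
  \<open>e * log 2 (y / x)\<close> is at most \<open>2 * ln (y / x)\<close>. Only the additive
  \<open>e\<close> has to stay small, and in this form \<open>x\<close> and \<open>y\<close> can be
  exchanged.\<close>

lemma regularly_varying_ln_bound:
  assumes g: "regularly_varying g \<rho>" and e: "e > 0" "e \<le> 1"
  shows "\<exists>x0>0. \<forall>x\<ge>x0. \<forall>y\<ge>x0. \<bar>ln (g y) - ln (g x)\<bar> \<le> (\<bar>\<rho>\<bar> + 2) * \<bar>ln (y / x)\<bar> + e"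
proof -
  obtain x0 where x0: "x0 > 0" and *: "\<And>x y. x \<ge> x0 \<Longrightarrow> y \<ge> x \<Longrightarrow>
     \<bar>ln (g y) - ln (g x) - \<rho> * ln (y / x)\<bar> \<le> e * (1 + log 2 (y / x))"
    using regularly_varying_potter[OF g e(1)] by blast
  have le: "\<bar>ln (g y) - ln (g x)\<bar> \<le> (\<bar>\<rho>\<bar> + 2) * \<bar>ln (y / x)\<bar> + e" if "x \<ge> x0" "y \<ge> x" for x y
  proof -
    have l: "ln (y/x) \<ge> 0" using that x0 by simp
    have ln2: "ln (2::real) \<ge> 1/2" using ln_le_minus_one[of "1/2::real"] by (simp add: ln_div)
    have "e * log 2 (y/x) \<le> 1 * (2 * ln (y/x))"
    proof (intro mult_mono e)
      have "ln (y/x) * 1 \<le> ln (y/x) * (2 * ln 2)" using l ln2 by (intro mult_left_mono) auto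
      then show "log 2 (y/x) \<le> 2 * ln (y/x)"
        by (simp add: log_def divide_simps mult_ac)
    qed (use e l in \<open>auto simp: log_def\<close>)
    moreover have "\<bar>\<rho> * ln (y / x)\<bar> = \<bar>\<rho>\<bar> * ln (y/x)" using l by (simp add: abs_mult)
    ultimately show ?thesis using *[OF that] l by (simp add: algebra_simps)
  qed
  show ?thesis
  proof (intro exI[of _ x0] conjI x0 allI impI)
    fix x y assume xy: "x \<ge> x0" "y \<ge> x0"
    show "\<bar>ln (g y) - ln (g x)\<bar> \<le> (\<bar>\<rho>\<bar> + 2) * \<bar>ln (y / x)\<bar> + e"
    proof (cases "y \<ge> x")
      case False
      with le[of y x] xy have "\<bar>ln (g x) - ln (g y)\<bar> \<le> (\<bar>\<rho>\<bar> + 2) * \<bar>ln (x / y)\<bar> + e" by simp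
      moreover have "\<bar>ln (x / y)\<bar> = \<bar>ln (y / x)\<bar>" using xy x0 by (simp add: ln_div abs_minus_commute)
      ultimately show ?thesis by (simp add: abs_minus_commute)
    qed (use le xy in auto)
  qed
qed

text \<open>The case \<open>u = 1\<close> yields vanishing increments of \<open>ln g\<close>; the
  other \<open>u\<close> serve to compare \<open>g'\<close> with its integral over a unit
  interval.\<close>

lemma regularly_varying_ln_shift:
  assumes g: "regularly_varying g \<rho>" and e: "e > 0"
  shows "\<forall>\<^sub>F n in sequentially. \<forall>u\<in>{0..1}. \<bar>ln (g (real n + u)) - ln (g (real n))\<bar> < e"
proof -
  define e' where "e' = min 1 (e / 2)"
  obtain x0 where x0: "x0 > 0" and *: "\<And>x y. x \<ge> x0 \<Longrightarrow> y \<ge> x0 \<Longrightarrow>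
     \<bar>ln (g y) - ln (g x)\<bar> \<le> (\<bar>\<rho>\<bar> + 2) * \<bar>ln (y / x)\<bar> + e'"
    using regularly_varying_ln_bound[OF g, of e'] e by (auto simp: e'_def)
  have "(\<lambda>n. (\<bar>\<rho>\<bar> + 2) * (1 / real n)) \<longlonglongrightarrow> (\<bar>\<rho>\<bar> + 2) * 0"
    by (intro tendsto_intros lim_1_over_n)
  then have "\<forall>\<^sub>F n in sequentially. (\<bar>\<rho>\<bar> + 2) * (1 / real n) < e / 2"
    using e by (intro order_tendstoD(2)) auto
  moreover have "\<forall>\<^sub>F n in sequentially. x0 \<le> real n"
    using filterlim_real_sequentially by (simp add: filterlim_at_top)
  ultimately show ?thesis
  proof (eventually_elim, intro ballI)
    case (elim n)
    fix u :: real assume u: "u \<in> {0..1}"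
    have "ln ((real n + u) / real n) \<le> (real n + u) / real n - 1"
      using elim x0 u by (intro ln_le_minus_one) auto
    also have "\<dots> \<le> 1 / real n" using elim x0 u by (simp add: field_simps)
    finally have "\<bar>ln ((real n + u) / real n)\<bar> \<le> 1 / real n"
      using elim x0 u by simp
    then have "(\<bar>\<rho>\<bar> + 2) * \<bar>ln ((real n + u) / real n)\<bar> \<le> (\<bar>\<rho>\<bar> + 2) * (1 / real n)"
      by (intro mult_left_mono) auto
    then show "\<bar>ln (g (real n + u)) - ln (g (real n))\<bar> < e"
      using *[of "real n" "real n + u"] elim u min.cobounded2[of 1 "e/2", folded e'_def]
      by (smt (verit) atLeastAtMost_iff field_sum_of_halves)
  qed
qed

lemma regularly_varying_ln_Suc:
  assumes "regularly_varying g \<rho>"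
  shows "(\<lambda>n. ln (g (real (Suc n))) - ln (g (real n))) \<longlonglongrightarrow> 0"
proof (rule tendstoI)
  fix e :: real assume "e > 0"
  from regularly_varying_ln_shift[OF assms this]
  show "\<forall>\<^sub>F n in sequentially. dist (ln (g (real (Suc n))) - ln (g (real n))) 0 < e"
    by eventually_elim (auto simp: dist_real_def add.commute dest!: bspec[of _ _ 1])
qed

text \<open>All increments from some index on are below \<open>e\<close>, and \<open>C\<close> is
  the total of the finitely many earlier ones, which makes it independent of \<open>r\<close>.
  Applied to the logarithm of \<open>sqrt (g n)\<close>, this bounds its change from any index on by
  an arbitrarily slow exponential.\<close>

lemma subexponential_growth:
  fixes a :: "nat \<Rightarrow> real"
  assumes a: "(\<lambda>n. a (Suc n) - a n) \<longlonglongrightarrow> 0" and e: "e > 0"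
  shows "\<exists>C\<ge>0. \<forall>r l. \<bar>a (r + l) - a r\<bar> \<le> C + e * real l"
proof -
  define d where "d n = \<bar>a (Suc n) - a n\<bar>" for n
  obtain n0 where n0: "\<And>n. n \<ge> n0 \<Longrightarrow> d n < e"
    using LIMSEQ_D[OF a e] by (auto simp: d_def)
  have "\<bar>a (r + l) - a r\<bar> \<le> (\<Sum>k<n0. d k) + e * real l" for r l
  proof -
    have "\<bar>a (r + l) - a r\<bar> = \<bar>\<Sum>k=r..<r+l. a (Suc k) - a k\<bar>" by (simp add: sum_Suc_diff')
    also have "\<dots> \<le> (\<Sum>k=r..<r+l. d k)" unfolding d_def by (rule sum_abs)
    also have "\<dots> \<le> (\<Sum>k=r..<r+l. (if k < n0 then d k else 0) + e)"
      using n0 e by (intro sum_mono) (auto simp: not_less less_imp_le)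
    also have "\<dots> = (\<Sum>k=r..<r+l. (if k < n0 then d k else 0)) + e * real l"
      by (simp add: sum.distrib)
    also have "(\<Sum>k=r..<r+l. (if k < n0 then d k else 0)) = (\<Sum>k\<in>{r..<r+l} \<inter> {..<n0}. d k)"
      by (simp add: sum.inter_restrict lessThan_def)
    also have "\<dots> \<le> (\<Sum>k<n0. d k)" by (rule sum_mono2) (auto simp: d_def)
    finally show ?thesis by simp
  qed
  then show ?thesis by (intro exI[of _ "\<Sum>k<n0. d k"]) (auto simp: d_def sum_nonneg)
qed

lemma subexponential_over_n:
  fixes a :: "nat \<Rightarrow> real"
  assumes a: "(\<lambda>n. a (Suc n) - a n) \<longlonglongrightarrow> 0"
  shows "(\<lambda>n. a n / real n) \<longlonglongrightarrow> 0"
proof (rule tendstoI)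
  fix e :: real assume e: "e > 0"
  obtain C where "\<forall>r l. \<bar>a (r + l) - a r\<bar> \<le> C + e/2 * real l"
    using subexponential_growth[OF a, of "e/2"] e by auto
  then have C: "\<bar>a (0 + l) - a 0\<bar> \<le> C + e/2 * real l" for l by blast
  have "(\<lambda>n. (\<bar>a 0\<bar> + C) * (1 / real n)) \<longlonglongrightarrow> (\<bar>a 0\<bar> + C) * 0"
    by (intro tendsto_intros lim_1_over_n)
  then have "\<forall>\<^sub>F n in sequentially. (\<bar>a 0\<bar> + C) * (1 / real n) < e / 2"
    using e by (intro order_tendstoD(2)) auto
  then show "\<forall>\<^sub>F n in sequentially. dist (a n / real n) 0 < e"
    using eventually_gt_at_top[of 0]
  proof eventually_elim
    case (elim n)
    have "\<bar>a n\<bar> \<le> \<bar>a 0\<bar> + C + e/2 * real n" using C[of n] by simp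
    then have "\<bar>a n\<bar> / real n \<le> (\<bar>a 0\<bar> + C + e/2 * real n) / real n"
      by (intro divide_right_mono) auto
    also have "\<dots> = (\<bar>a 0\<bar> + C) * (1 / real n) + e / 2" using elim by (simp add: field_simps)
    also have "\<dots> < e / 2 + e / 2" using elim(1) by (rule add_strict_right_mono)
    finally show ?case using elim by (simp add: dist_real_def)
  qed
qed

section \<open>The normalised function \<open>Phi\<close>\<close>

lemma powr_mult_exp_minus_one_le:
  fixes w p s d :: real
  assumes w: "w > 0" and p: "p \<ge> 1" and d: "0 < d" "d \<le> 1/4" and s: "\<bar>s\<bar> \<le> d * (1 + \<bar>ln w\<bar>)"
  shows "\<bar>w powr p * exp s - w powr p\<bar> \<le> 8 * d * (1 + w powr (2 * p))"
proof -
  define u where "u = 1 + \<bar>ln w\<bar>"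
  have u: "u \<ge> 1" by (simp add: u_def)
  have "\<bar>exp s - 1\<bar> \<le> \<bar>s\<bar> * exp \<bar>s\<bar>"
  proof (cases "s \<ge> 0")
    case True
    have "1 - s \<le> exp (- s)" using exp_ge_add_one_self[of "-s"] by simp
    then have "(1 - s) * exp s \<le> 1" by (simp add: exp_minus field_simps)
    then show ?thesis using True by (simp add: algebra_simps)
  next
    case False
    have "1 - exp s \<le> - s" using exp_ge_add_one_self[of s] by linarith
    also have "- s \<le> - s * exp (- s)" using False by (simp add: mult_le_cancel_left1)
    finally show ?thesis using False by simp
  qed
  \<comment> \<open>With \<open>\<bar>s\<bar> \<le> u / 4\<close> and
    \<open>u \<le> 4 * exp (u / 4)\<close> everything collapses to a multiple of
    \<open>exp (u / 2)\<close>, which is up to a constant half a power of \<open>w\<close> or of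
    \<open>1 / w\<close>.\<close>
  also have "\<dots> \<le> (d * u) * exp (u / 4)"
  proof (intro mult_mono s[folded u_def])
    have "d * u \<le> 1/4 * u" using d u by (intro mult_right_mono) auto
    then show "exp \<bar>s\<bar> \<le> exp (u / 4)" using s[folded u_def] by simp
  qed (use d u in auto)
  also have "\<dots> \<le> (d * (4 * exp (u / 4))) * exp (u / 4)"
  proof (intro mult_mono)
    show "u \<le> 4 * exp (u / 4)" using exp_ge_add_one_self[of "u/4"] u by linarith
  qed (use u d in auto)
  also have "\<dots> = 4 * d * exp (u / 2)" by (simp add: exp_add[symmetric] mult_ac)
  also have "exp (u / 2) = exp (1/2) * exp (\<bar>ln w\<bar> / 2)" by (simp add: u_def exp_add[symmetric] add_divide_distrib)
  also have "exp (1/2::real) \<le> 2"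
  proof -
    have "exp (1/2::real) ^ 2 = exp 1" by (simp add: power2_eq_square exp_add[symmetric])
    also have "\<dots> \<le> 2 ^ 2" using exp_le by simp
    finally show ?thesis by (rule power2_le_imp_le) simp
  qed
  finally have E: "\<bar>exp s - 1\<bar> \<le> 8 * d * exp (\<bar>ln w\<bar> / 2)"
    using d by (simp add: mult_right_mono)
  \<comment> \<open>The half power is absorbed because \<open>p - 1/2\<close> and
    \<open>p + 1/2\<close> both lie between 0 and \<open>2 * p\<close>.\<close>
  have "w powr p * exp (\<bar>ln w\<bar> / 2) \<le> 1 + w powr (2 * p)"
  proof (cases "w \<ge> 1")
    case True
    then have "w powr p * exp (\<bar>ln w\<bar> / 2) = w powr (p + 1/2)" using w by (simp add: powr_def exp_add[symmetric] algebra_simps)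
    also have "\<dots> \<le> w powr (2 * p)" using True p by (intro powr_mono) auto
    finally show ?thesis by simp
  next
    case False
    then have "w powr p * exp (\<bar>ln w\<bar> / 2) = w powr (p - 1/2)" using w by (simp add: powr_def exp_add[symmetric] algebra_simps)
    also have "\<dots> \<le> 1" using False p w by (intro powr_le1) auto
    finally show ?thesis by (simp add: add_increasing2)
  qed
  then have "w powr p * (8 * d * exp (\<bar>ln w\<bar> / 2)) \<le> 8 * d * (1 + w powr (2 * p))"
    using d by (simp add: mult.left_commute mult_left_mono)
  moreover have "w powr p * exp s - w powr p = w powr p * (exp s - 1)"
    by (simp add: right_diff_distrib)
  then have "\<bar>w powr p * exp s - w powr p\<bar> = w powr p * \<bar>exp s - 1\<bar>"
    by (simp only: abs_mult) simp
  moreover have "w powr p * \<bar>exp s - 1\<bar> \<le> w powr p * (8 * d * exp (\<bar>ln w\<bar> / 2))"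
    by (intro mult_left_mono E) auto
  ultimately show ?thesis by linarith
qed

lemma abs_ln_le:
  fixes x :: real assumes "x \<ge> 1/2" shows "\<bar>ln x\<bar> \<le> 2 * \<bar>x - 1\<bar>"
proof (cases "x \<ge> 1")
  case False
  have "ln (1/x) \<le> 1/x - 1" using assms by (intro ln_le_minus_one) auto
  also have "1/x - 1 = (1 - x) / x" using assms by (simp add: field_simps)
  also have "\<dots> \<le> (1 - x) / (1/2)" using assms False by (intro divide_left_mono) auto
  finally show ?thesis using assms False by (simp add: ln_div)
qed (use ln_le_minus_one[of x] in auto)

text \<open>The powers of 2 and of \<open>g\<close> would cancel exactly if \<open>Phi\<close>
  evaluated \<open>g\<close> at \<open>n\<close>; it does so at a point \<open>y\<close> instead,
  and \<open>exp s\<close> records the discrepancy. Uniformly in \<open>w\<close>, the difference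
  \<open>y / n - 1\<close> is small against \<open>1 + \<bar>ln w\<bar>\<close>, hence so is
  \<open>s\<close>. The range up to \<open>2 * n\<close> keeps \<open>y\<close> above
  \<open>n / 2\<close>, where the uniform bounds are available.\<close>

lemma Phi_rescaled:
  assumes g: "regularly_varying g \<rho>" and q: "0 \<le> q" "q < 1" and p: "p = 1 / (1 - q)" and e: "e > 0"
  shows "\<forall>\<^sub>F n in sequentially. \<forall>w. 0 \<le> w \<and> w \<le> 2 * real n \<longrightarrow>
    \<bar>2 ^ n * Phi g q (2 powr (- (real n * (1 - q))) * sqrt (g (real n)) * w) - w powr p\<bar>
      \<le> e * (1 + w powr (2 * p))"
proof -
  have pos: "g x > 0" if "x \<ge> 0" for x using g that by (simp add: regularly_varying_def)
  have p1: "p \<ge> 1" and pq: "p * (1 - q) = 1" using q by (auto simp: p field_simps)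
  \<comment> \<open>\<open>h\<close> is the factor aimed at in the bound on \<open>s\<close>: at
    most 1/4, as \<open>powr_mult_exp_minus_one_le\<close> demands, and
    \<open>8 * h \<le> e\<close>. The choices of \<open>d\<close> and \<open>e'\<close> give half of
    it to the logarithmic part and half to the additive part.\<close>
  define h where "h = min (1/4) (e / 8)"
  have h: "h > 0" "h \<le> 1/4" "8 * h \<le> e" using e by (auto simp: h_def)
  define d where "d = h / (p * (\<bar>\<rho>\<bar> + 2))"
  have d: "d > 0" using h p1 by (auto simp: d_def)
  define e' where "e' = min 1 (h / p)"
  have e': "e' > 0" "e' \<le> 1" "p * e' \<le> h"
    using h p1 by (auto simp: e'_def min_def field_simps)
  obtain x0 where x0: "x0 > 0" and *: "\<And>x y. x \<ge> x0 \<Longrightarrow> y \<ge> x0 \<Longrightarrow>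
     \<bar>ln (g y) - ln (g x)\<bar> \<le> (\<bar>\<rho>\<bar> + 2) * \<bar>ln (y / x)\<bar> + e'"
    using regularly_varying_ln_bound[OF g e'(1,2)] by blast
  \<comment> \<open>The relative displacement of \<open>y\<close> caused by \<open>g n\<close>; it
    vanishes in the limit because \<open>ln (g n)\<close> is \<open>o(n)\<close>.\<close>
  define b where "b n = p / 2 * \<bar>log 2 (g (real n))\<bar> / real n" for n
  have "(\<lambda>n. p / 2 / ln 2 * \<bar>ln (g (real n)) / real n\<bar>) \<longlonglongrightarrow> p / 2 / ln 2 * \<bar>0\<bar>"
    by (intro tendsto_intros subexponential_over_n regularly_varying_ln_Suc[OF g])
  then have b0: "b \<longlonglongrightarrow> 0" by (simp add: b_def[abs_def] log_def abs_divide field_simps)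
  have ev1: "\<forall>\<^sub>F n in sequentially. b n < min (d / 2) (1/4)"
    using d by (intro order_tendstoD(2)[OF b0]) auto
  have "(\<lambda>n. p * log 2 (2 * real n) / real n) \<longlonglongrightarrow> 0" by real_asymp
  then have ev2: "\<forall>\<^sub>F n in sequentially. p * log 2 (2 * real n) / real n < 1/4"
    by (intro order_tendstoD(2)) auto
  have "(\<lambda>n. p / ln 2 * (1 / real n)) \<longlonglongrightarrow> p / ln 2 * 0"
    by (intro tendsto_intros lim_1_over_n)
  then have ev3: "\<forall>\<^sub>F n in sequentially. p / ln 2 * (1 / real n) < d / 2"
    using d by (intro order_tendstoD(2)) auto
  have ev4: "\<forall>\<^sub>F n in sequentially. 2 * x0 \<le> real n"
    using filterlim_real_sequentially by (simp add: filterlim_at_top)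
  from ev1 ev2 ev3 ev4 show ?thesis
  proof (eventually_elim, intro allI impI)
    case (elim n)
    fix w :: real assume w: "0 \<le> w \<and> w \<le> 2 * real n"
    have n: "real n > 0" "real n \<ge> x0" using elim x0 by auto
    show "\<bar>2 ^ n * Phi g q (2 powr (- (real n * (1 - q))) * sqrt (g (real n)) * w) - w powr p\<bar>
      \<le> e * (1 + w powr (2 * p))"
    proof (cases "w = 0")
      case True
      then show ?thesis using e by (simp add: Phi_def)
    next
      case False
      with w have w: "0 < w" "w \<le> 2 * real n" by auto
      define x where "x = 2 powr (- (real n * (1 - q))) * sqrt (g (real n)) * w"
      define y where "y = real n - p / 2 * log 2 (g (real n)) - p * log 2 w"
      have gn: "g (real n) > 0" by (rule pos) simp
      have x: "x > 0" using gn w by (simp add: x_def)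
      have lx: "ln x = - (real n * (1 - q)) * ln 2 + ln (g (real n)) / 2 + ln w"
        unfolding x_def using gn w by (simp add: ln_mult ln_powr ln_sqrt)
      have npq: "p * (n * (1 - q)) = n" using pq by (simp add: mult.left_commute)
      have y: "- log 2 x / (1 - q) = y"
      proof -
        have "- log 2 x / (1 - q) = - (p * ln x) / ln 2" by (simp add: log_def p)
        also have "p * ln x = - (p * (n * (1 - q))) * ln 2 + p * ln (g (real n)) / 2 + p * ln w"
          by (simp add: lx algebra_simps)
        also have "- (- (p * (n * (1 - q))) * ln 2 + p * ln (g (real n)) / 2 + p * ln w) / ln 2 = y"
          unfolding npq by (simp add: y_def log_def add_divide_distrib diff_divide_distrib)
        finally show ?thesis .
      qed
      have yn: "\<bar>y / real n - 1\<bar> \<le> b n + p / ln 2 * (1 / real n) * \<bar>ln w\<bar>"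
      proof -
        have "y / real n - 1 = - (p / 2 * log 2 (g (real n)) / real n + p / ln 2 * (1 / real n) * ln w)"
          using n by (simp add: y_def log_def field_simps)
        also have "\<bar>\<dots>\<bar> \<le> \<bar>p / 2 * log 2 (g (real n)) / real n\<bar> + \<bar>p / ln 2 * (1 / real n) * ln w\<bar>"
          unfolding abs_minus_cancel by (rule abs_triangle_ineq)
        also have "\<dots> = b n + p / ln 2 * (1 / real n) * \<bar>ln w\<bar>"
          using n p1 by (simp add: b_def abs_mult)
        finally show ?thesis .
      qed
      \<comment> \<open>A small \<open>w\<close> only moves \<open>y\<close> upwards, so it is the
        upper bound on \<open>w\<close> that counts here.\<close>
      have yhalf: "y / real n \<ge> 1/2"
      proof -
        have "y / real n = 1 - p / 2 * log 2 (g (real n)) / real n - p * log 2 w / real n"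
          using n by (simp add: y_def field_simps)
        moreover have "p / 2 * log 2 (g (real n)) / real n \<le> b n"
          unfolding b_def using p1 n by (intro divide_right_mono mult_left_mono) auto
        moreover have "p * log 2 w / real n \<le> p * log 2 (2 * real n) / real n"
          using p1 n w by (intro divide_right_mono mult_left_mono) auto
        ultimately show ?thesis using elim by linarith
      qed
      then have "y \<ge> real n / 2" using n by (simp add: field_simps)
      then have yx0: "y \<ge> x0" using elim by simp
      with x0 have y0: "y > 0" by simp
      have "\<bar>ln (y / real n)\<bar> \<le> 2 * (b n + p / ln 2 * (1 / real n) * \<bar>ln w\<bar>)"
        by (rule order_trans[OF abs_ln_le[OF yhalf]]) (intro mult_left_mono yn, simp)
      also have "\<dots> \<le> 2 * (d / 2 + d / 2 * \<bar>ln w\<bar>)"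
        using elim by (intro mult_left_mono add_mono mult_right_mono) auto
      finally have lyn: "\<bar>ln (y / real n)\<bar> \<le> d * (1 + \<bar>ln w\<bar>)" by (simp add: algebra_simps)
      define s where "s = p / 2 * (ln (g (real n)) - ln (g y))"
      have "\<bar>s\<bar> = p / 2 * \<bar>ln (g y) - ln (g (real n))\<bar>"
        using p1 by (simp add: s_def abs_mult abs_minus_commute)
      also have "\<dots> \<le> p / 2 * ((\<bar>\<rho>\<bar> + 2) * (d * (1 + \<bar>ln w\<bar>)) + e')"
      proof (intro mult_left_mono order_trans[OF *[OF n(2) yx0]] add_mono lyn)
      qed (use p1 in auto)
      also have "\<dots> = (p * (\<bar>\<rho>\<bar> + 2) * d) / 2 * (1 + \<bar>ln w\<bar>) + p * e' / 2" by (simp add: algebra_simps)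
      also have "p * (\<bar>\<rho>\<bar> + 2) * d = h" using p1 by (simp add: d_def)
      also have "h / 2 * (1 + \<bar>ln w\<bar>) + p * e' / 2 \<le> h / 2 * (1 + \<bar>ln w\<bar>) + h / 2 * (1 + \<bar>ln w\<bar>)"
        proof -
          have "h * 1 \<le> h * (1 + \<bar>ln w\<bar>)" using h by (intro mult_left_mono) auto
          then show ?thesis using e' by linarith
        qed
      finally have s: "\<bar>s\<bar> \<le> h * (1 + \<bar>ln w\<bar>)" by simp
      have "2 ^ n * Phi g q x = w powr p * exp s"
      proof -
        have pp: "1 / (2 * (1 - q)) = p / 2" by (simp add: p)
        have "Phi g q x = x powr (1 / (1 - q)) * g (- log 2 x / (1 - q)) powr (- (1 / (2 * (1 - q))))"
          using x unfolding Phi_def by simp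
        also have "\<dots> = x powr p * g y powr (- (p / 2))" unfolding y pp p by (rule refl)
        also have "\<dots> = exp (p * ln x - p / 2 * ln (g y))"
          using x pos[of y] y0 by (simp add: powr_def exp_add[symmetric])
        also have "p * ln x - p / 2 * ln (g y) = - (p * (n * (1 - q))) * ln 2 + (p * ln w + s)"
          by (simp add: lx s_def algebra_simps)
        also have "exp \<dots> = exp (- real n * ln 2) * (w powr p * exp s)"
          unfolding npq exp_add using w by (simp add: powr_def)
        also have "exp (- real n * ln 2) = 1 / 2 ^ n"
          by (simp add: exp_minus inverse_eq_divide exp_of_nat_mult)
        finally show ?thesis by simp
      qed
      then have "\<bar>2 ^ n * Phi g q x - w powr p\<bar> \<le> 8 * h * (1 + w powr (2 * p))"
        using powr_mult_exp_minus_one_le[OF w(1) p1 h(1,2) s] by simp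
      also have "\<dots> \<le> e * (1 + w powr (2 * p))"
        using h by (intro mult_right_mono) (auto simp: add_nonneg_nonneg)
      finally show ?thesis by (simp add: x_def)
    qed
  qed
qed

section \<open>Increments of signed tent series\<close>

lemma tent_eq_min:
  assumes "of_int i \<le> x" "x \<le> of_int i + 1"
  shows "tent x = min (x - of_int i) (of_int i + 1 - x)"
proof (rule antisym)
  have bdd: "bdd_below (range (\<lambda>z. \<bar>of_int z - x\<bar>))" by (rule bdd_belowI[of _ 0]) auto
  show "tent x \<le> min (x - of_int i) (of_int i + 1 - x)"
    unfolding tent_def using assms cINF_lower[OF bdd, of i] cINF_lower[OF bdd, of "i + 1"] by auto
  show "min (x - of_int i) (of_int i + 1 - x) \<le> tent x"
    unfolding tent_def
  proof (rule cINF_greatest)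
    fix z :: int
    have "z \<le> i \<or> z \<ge> i + 1" by linarith
    then have "real_of_int z \<le> of_int i \<or> real_of_int z \<ge> of_int i + 1" by linarith
    then show "min (x - of_int i) (of_int i + 1 - x) \<le> \<bar>of_int z - x\<bar>" using assms by linarith
  qed simp
qed

lemma tent_of_nat [simp]: "tent (real k) = 0"
  using tent_eq_min[of "int k" "real k"] by simp

lemma tent_bounds: "0 \<le> tent x" "tent x \<le> 1"
proof -
  have "real_of_int \<lfloor>x\<rfloor> \<le> x" "x \<le> real_of_int \<lfloor>x\<rfloor> + 1" by linarith+
  from tent_eq_min[OF this] this show "0 \<le> tent x" "tent x \<le> 1" by linarith+
qed

lemma tent_midpoint:
  assumes "real j / 2 \<le> x" "x \<le> (real j + 1) / 2" "real j / 2 \<le> y" "y \<le> (real j + 1) / 2"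
  shows "tent ((x + y) / 2) = (tent x + tent y) / 2"
proof -
  define i where "i = int (j div 2)"
  show ?thesis
  proof (cases "even j")
    case True
    then have j: "real j = 2 * of_int i" by (auto simp: i_def elim!: evenE)
    have "tent t = t - of_int i" if "real j / 2 \<le> t" "t \<le> (real j + 1) / 2" for t
      using tent_eq_min[of i t] that j by auto
    from this[of x] this[of y] this[of "(x+y)/2"] assms show ?thesis by (simp add: field_simps)
  next
    case False
    then have j: "real j = 2 * of_int i + 1" by (auto simp: i_def elim!: oddE)
    have "tent t = of_int i + 1 - t" if "real j / 2 \<le> t" "t \<le> (real j + 1) / 2" for t
      using tent_eq_min[of i t] that j by auto
    from this[of x] this[of y] this[of "(x+y)/2"] assms show ?thesis by (simp add: field_simps)
  qed
qed

lemma continuous_on_tent: "continuous_on A tent"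
proof -
  have "tent t = infdist t \<int>" for t
    by (simp add: tent_def infdist_def Ints_def image_image dist_real_def abs_minus_commute)
  then show ?thesis by (simp add: continuous_on_infdist[OF continuous_on_id])
qed

text \<open>A jump of the sign at the right endpoint is invisible because the tent map vanishes
  there, so the sign can be frozen on the closed interval. This is why discontinuous signs still
  give continuous functions.\<close>

lemma dyadic_sign_mult_tent:
  assumes s: "dyadic_sign m s" and i: "i < 2 ^ m" and t: "real i / 2 ^ m \<le> t" "t \<le> (real i + 1) / 2 ^ m"
  shows "s t * tent (2 ^ m * t) = s (real i / 2 ^ m) * tent (2 ^ m * t)"
proof (cases "t = (real i + 1) / 2 ^ m")
  case True
  then have "2 ^ m * t = real (Suc i)" by simp
  then show ?thesis by (simp only: tent_of_nat)
next
  case False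
  have "Suc i \<in> {1..2 ^ m}" using i by auto
  then have "s constant_on {(real (Suc i) - 1) / 2 ^ m ..< real (Suc i) / 2 ^ m}"
    using s unfolding dyadic_sign_def by blast
  then have "s t = s (real i / 2 ^ m)"
    using t False by (auto simp: constant_on_def divide_strict_right_mono add.commute)
  then show ?thesis by simp
qed

lemma continuous_on_dyadic_sign_tent:
  assumes s: "dyadic_sign m s"
  shows "continuous_on {0..1} (\<lambda>t. s t * tent (2 ^ m * t))"
proof -
  define J where "J i = {real i / 2 ^ m..(real i + 1) / 2 ^ m}" for i
  have "continuous_on (\<Union>i\<in>{..<2^m}. J i) (\<lambda>t. s t * tent (2 ^ m * t))"
  proof (rule continuous_on_closed_Union)
    fix i :: nat assume i: "i \<in> {..<2^m}"
    have "continuous_on (J i) (\<lambda>t. s (real i / 2 ^ m) * tent (2 ^ m * t))"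
      by (intro continuous_intros continuous_on_compose2[OF continuous_on_tent[of UNIV]]) auto
    then show "continuous_on (J i) (\<lambda>t. s t * tent (2 ^ m * t))"
      by (rule continuous_on_eq) (rule dyadic_sign_mult_tent[OF s, symmetric], use i in \<open>auto simp: J_def\<close>)
  qed (auto simp: J_def)
  moreover have "{0..1} \<subseteq> (\<Union>i\<in>{..<2^m}. J i)"
  proof
    fix t :: real assume t: "t \<in> {0..1}"
    show "t \<in> (\<Union>i\<in>{..<2^m}. J i)"
    proof (cases "t = 1")
      case True
      then have "t \<in> J (2 ^ m - 1)" by (auto simp: J_def of_nat_diff field_simps)
      then show ?thesis by (intro UN_I[of "2 ^ m - 1"]) auto
    next
      case False
      define i where "i = nat \<lfloor>t * 2 ^ m\<rfloor>"
      have i: "real i \<le> t * 2 ^ m" "t * 2 ^ m \<le> real i + 1"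
        using t unfolding i_def by (auto simp: le_floor_iff)
      have "t * 2 ^ m < 1 * 2 ^ m" using t False by (intro mult_strict_right_mono) auto
      with i have "real i < 2 ^ m" by linarith
      then have "real i < real (2 ^ m)" by simp
      then have "i < 2 ^ m" by (simp only: of_nat_less_iff)
      moreover have "t \<in> J i" using i by (auto simp: J_def field_simps)
      ultimately show ?thesis by blast
    qed
  qed
  ultimately show ?thesis by (rule continuous_on_subset)
qed

lemma abs_dyadic_sign_tent_le:
  assumes "dyadic_sign m s" "t \<in> {0..1}"
  shows "\<bar>a * s t * tent (2 ^ m * t)\<bar> \<le> \<bar>a\<bar>"
proof -
  have "s t \<in> {-1, 1}" using assms unfolding dyadic_sign_def by blast
  then have "\<bar>s t\<bar> = 1" by auto
  then show ?thesis using tent_bounds[of "2 ^ m * t"] by (simp add: abs_mult mult_left_le)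
qed

lemma continuous_on_signed_tent_series:
  assumes s: "\<And>m. dyadic_sign m (\<sigma> m)" and a: "summable (\<lambda>m. \<bar>\<alpha> m\<bar>)"
  shows "continuous_on {0..1} (signed_tent_series \<alpha> \<sigma>)"
proof -
  have "uniform_limit {0..1} (\<lambda>n t. \<Sum>m<n. \<alpha> m * \<sigma> m t * tent (2 ^ m * t)) (signed_tent_series \<alpha> \<sigma>) sequentially"
    unfolding signed_tent_series_def[abs_def]
    by (rule Weierstrass_m_test[OF _ a]) (use abs_dyadic_sign_tent_le[OF s] in auto)
  then show ?thesis
  proof (rule uniform_limit_theorem[rotated])
    show "\<forall>\<^sub>F n in sequentially. continuous_on {0..1} (\<lambda>t. \<Sum>m<n. \<alpha> m * \<sigma> m t * tent (2 ^ m * t))"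
      unfolding mult.assoc
      by (intro always_eventually allI continuous_on_sum continuous_on_mult_left continuous_on_dyadic_sign_tent s)
  qed simp
qed

text \<open>Coarser terms are affine on an interval of level \<open>n\<close>, finer ones vanish at
  its endpoints and its midpoint. Only the term of level \<open>n\<close> bends, by the height 1/2
  of the tent.\<close>

lemma dyadic_sign_tent_midpoint:
  assumes s: "dyadic_sign m s" and k: "k < 2 ^ n"
  defines "l \<equiv> real k / 2 ^ n" and "r \<equiv> (real k + 1) / 2 ^ n"
  shows "s ((l + r) / 2) * tent (2 ^ m * ((l + r) / 2)) - (s l * tent (2 ^ m * l) + s r * tent (2 ^ m * r)) / 2
    = (if m = n then s l / 2 else 0)"
proof (cases "m < n")
  case True
  define d where "d = n - m - 1"
  have n: "n = m + Suc d" using True by (simp add: d_def)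
  \<comment> \<open>\<open>i\<close> is the interval of level \<open>m\<close> that contains
    \<open>l\<close> and \<open>r\<close>, where the sign is frozen; \<open>j\<close> is the half of
    it on which the tent map is affine.\<close>
  define i where "i = k div 2 ^ Suc d"
  define j where "j = k div 2 ^ d"
  have div_bounds: "real (a div 2 ^ b) * 2 ^ b \<le> real a" "real a + 1 \<le> (real (a div 2 ^ b) + 1) * 2 ^ b" for a b :: nat
  proof -
    have "a div 2 ^ b * 2 ^ b \<le> a" by simp
    then have "real (a div 2 ^ b * 2 ^ b) \<le> real a" by (simp only: of_nat_le_iff)
    then show "real (a div 2 ^ b) * 2 ^ b \<le> real a" by simp
    have "a < (a div 2 ^ b + 1) * 2 ^ b" using dividend_less_div_times[of "2 ^ b" a] by (simp add: algebra_simps)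
    then have "real (a + 1) \<le> real ((a div 2 ^ b + 1) * 2 ^ b)" by (simp only: of_nat_le_iff)
    then show "real a + 1 \<le> (real (a div 2 ^ b) + 1) * 2 ^ b" by (simp add: algebra_simps)
  qed
  have i: "i < 2 ^ m" using k unfolding i_def n by (simp add: less_mult_imp_div_less power_add)
  have lr_eq: "l = real k / 2 ^ Suc d / 2 ^ m" "r = (real k + 1) / 2 ^ Suc d / 2 ^ m"
    by (simp_all add: l_def r_def n power_add)
  have "real i \<le> real k / 2 ^ Suc d" "(real k + 1) / 2 ^ Suc d \<le> real i + 1"
    using div_bounds[of k "Suc d", folded i_def] by (simp_all add: le_divide_eq divide_le_eq)
  then have lr: "real i / 2 ^ m \<le> l" "r \<le> (real i + 1) / 2 ^ m" "l \<le> r"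
    unfolding lr_eq by (intro divide_right_mono; simp)+
  have ml_eq: "2 ^ m * l = real k / 2 ^ d / 2" "2 ^ m * r = (real k + 1) / 2 ^ d / 2"
    by (simp_all add: l_def r_def n power_add)
  have "real j \<le> real k / 2 ^ d" "(real k + 1) / 2 ^ d \<le> real j + 1"
    using div_bounds[of k d, folded j_def] by (simp_all add: le_divide_eq divide_le_eq)
  then have jl: "real j / 2 \<le> 2 ^ m * l" "2 ^ m * r \<le> (real j + 1) / 2"
    unfolding ml_eq by (intro divide_right_mono; simp)+
  have lr': "2 ^ m * l \<le> 2 ^ m * r" using lr by simp
  have c: "2 ^ m * ((l + r) / 2) = (2 ^ m * l + 2 ^ m * r) / 2" by (simp add: algebra_simps)
  have mid: "tent (2 ^ m * ((l + r) / 2)) = (tent (2 ^ m * l) + tent (2 ^ m * r)) / 2"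
    unfolding c by (rule tent_midpoint[of j]; use jl lr' in linarith)
  have "s t * tent (2 ^ m * t) = s (real i / 2 ^ m) * tent (2 ^ m * t)" if "l \<le> t" "t \<le> r" for t
    by (rule dyadic_sign_mult_tent[OF s i]) (use that lr in auto)
  from this[of l] this[of r] this[of "(l + r) / 2"] lr
  have piece: "s l * tent (2 ^ m * l) = s (real i / 2 ^ m) * tent (2 ^ m * l)"
    "s r * tent (2 ^ m * r) = s (real i / 2 ^ m) * tent (2 ^ m * r)"
    "s ((l + r) / 2) * tent (2 ^ m * ((l + r) / 2)) = s (real i / 2 ^ m) * tent (2 ^ m * ((l + r) / 2))"
    by auto
  show ?thesis unfolding piece unfolding mid using True by (simp add: algebra_simps add_divide_distrib)
next
  case False
  define d where "d = m - n"
  have m: "m = n + d" using False by (simp add: d_def)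
  have "2 ^ m * l = real (2 ^ d * k)" "2 ^ m * r = real (2 ^ d * Suc k)"
    by (simp_all add: l_def r_def m power_add field_simps)
  then have z: "tent (2 ^ m * l) = 0" "tent (2 ^ m * r) = 0" by (simp_all only: tent_of_nat)
  show ?thesis
  proof (cases d)
    case 0
    then have mn: "m = n" by (simp add: m)
    have A: "s ((l + r) / 2) * tent (2 ^ m * ((l + r) / 2)) = s l * tent (2 ^ m * ((l + r) / 2))"
      unfolding l_def mn[symmetric] by (rule dyadic_sign_mult_tent[OF s])
        (use k in \<open>auto simp: r_def mn field_simps\<close>)
    have B: "2 ^ m * ((l + r) / 2) = real k + 1/2" by (simp add: l_def r_def mn field_simps)
    have T: "tent (real k + 1/2) = 1/2" using tent_eq_min[of "int k" "real k + 1/2"] by simp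
    show ?thesis unfolding A unfolding B T z using mn by simp
  next
    case (Suc d')
    have "2 ^ m * ((l + r) / 2) = real (2 ^ d' * (2 * k + 1))"
      by (simp add: l_def r_def m Suc power_add field_simps)
    then have "tent (2 ^ m * ((l + r) / 2)) = 0" by (simp only: tent_of_nat)
    then show ?thesis using z Suc m by simp
  qed
qed

section \<open>Slopes over dyadic intervals\<close>

definition dyadic_slope :: "(real \<Rightarrow> real) \<Rightarrow> nat \<Rightarrow> nat \<Rightarrow> real" where
  "dyadic_slope f n k = 2 ^ n * (f ((real k + 1) / 2 ^ n) - f (real k / 2 ^ n))"

text \<open>At the midpoint \<open>f\<close> deviates from the mean of its end values by
  \<open>\<alpha> n * \<sigma> n l / 2\<close>, and over half the length this changes the slope by
  \<open>2 ^ n * \<alpha> n\<close> up to sign. The sign stays behind a quantifier because only the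
  unordered pair of new slopes is used.\<close>

lemma dyadic_slope_signed_tent_series_Suc:
  assumes s: "\<And>m. dyadic_sign m (\<sigma> m)" and a: "summable (\<lambda>m. \<bar>\<alpha> m\<bar>)" and k: "k < 2 ^ n"
  defines "f \<equiv> signed_tent_series \<alpha> \<sigma>"
  shows "\<exists>e\<in>{-1, 1}. dyadic_slope f (Suc n) (2 * k) = dyadic_slope f n k + e * (2 ^ n * \<alpha> n) \<and>
    dyadic_slope f (Suc n) (2 * k + 1) = dyadic_slope f n k - e * (2 ^ n * \<alpha> n)"
proof -
  define l where "l = real k / 2 ^ n"
  define r where "r = (real k + 1) / 2 ^ n"
  define c where "c = (l + r) / 2"
  have "real k + 1 \<le> 2 ^ n"
  proof -
    have "real (k + 1) \<le> real (2 ^ n)" using k by (simp only: of_nat_le_iff)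
    then show ?thesis by simp
  qed
  then have lrc: "l \<in> {0..1}" "r \<in> {0..1}" "c \<in> {0..1}"
    using k by (auto simp: l_def r_def c_def field_simps)
  have sums: "(\<lambda>m. \<alpha> m * \<sigma> m t * tent (2 ^ m * t)) sums f t" if "t \<in> {0..1}" for t
    unfolding f_def signed_tent_series_def
    by (rule summable_sums, rule summable_comparison_test'[OF a, of 0])
      (use abs_dyadic_sign_tent_le[OF s that] in auto)
  have "(\<lambda>m. \<alpha> m * \<sigma> m c * tent (2 ^ m * c)
       - (\<alpha> m * \<sigma> m l * tent (2 ^ m * l) + \<alpha> m * \<sigma> m r * tent (2 ^ m * r)) / 2) sums (f c - (f l + f r) / 2)"
    by (intro sums_diff sums_divide sums_add sums lrc)
  also have "(\<lambda>m. \<alpha> m * \<sigma> m c * tent (2 ^ m * c)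
       - (\<alpha> m * \<sigma> m l * tent (2 ^ m * l) + \<alpha> m * \<sigma> m r * tent (2 ^ m * r)) / 2)
     = (\<lambda>m. \<alpha> m * (\<sigma> m c * tent (2 ^ m * c) - (\<sigma> m l * tent (2 ^ m * l) + \<sigma> m r * tent (2 ^ m * r)) / 2))"
    by (simp add: algebra_simps add_divide_distrib)
  also have "\<dots> = (\<lambda>m. if m = n then \<alpha> n * \<sigma> n l / 2 else 0)"
    using dyadic_sign_tent_midpoint[OF s k, folded l_def r_def, folded c_def] by (auto simp: fun_eq_iff)
  finally have "f c - (f l + f r) / 2 = \<alpha> n * \<sigma> n l / 2"
    using sums_single[of n "\<lambda>_. \<alpha> n * \<sigma> n l / 2"] by (metis (no_types, lifting) sums_unique2)
  then have fc: "f c = (f l + f r) / 2 + \<alpha> n * \<sigma> n l / 2" by linarith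
  have pts: "real (2 * k) / 2 ^ Suc n = l" "(real (2 * k) + 1) / 2 ^ Suc n = c"
    "real (2 * k + 1) / 2 ^ Suc n = c" "(real (2 * k + 1) + 1) / 2 ^ Suc n = r"
    by (auto simp: l_def r_def c_def field_simps)
  show ?thesis
  proof (intro bexI[of _ "\<sigma> n l"] conjI)
    show "\<sigma> n l \<in> {-1, 1}" using s[of n] lrc by (auto simp: dyadic_sign_def)
    show "dyadic_slope f (Suc n) (2 * k) = dyadic_slope f n k + \<sigma> n l * (2 ^ n * \<alpha> n)"
      "dyadic_slope f (Suc n) (2 * k + 1) = dyadic_slope f n k - \<sigma> n l * (2 ^ n * \<alpha> n)"
      unfolding dyadic_slope_def pts unfolding l_def[symmetric] r_def[symmetric] fc by (simp_all add: algebra_simps)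
  qed
qed

lemma dyadic_slope_signed_tent_series_0:
  "dyadic_slope (signed_tent_series \<alpha> \<sigma>) 0 0 = 0"
proof -
  have "tent (2 ^ m) = 0" "tent 0 = 0" for m
    using tent_of_nat[of "2 ^ m"] tent_of_nat[of 0] by auto
  then show ?thesis by (simp add: dyadic_slope_def signed_tent_series_def)
qed

text \<open>The mean of \<open>h (x \<plusminus> b 0 \<plusminus> \<dots> \<plusminus> b (n - 1))\<close> over all choices of signs.\<close>
fun sign_mean :: "(nat \<Rightarrow> real) \<Rightarrow> nat \<Rightarrow> (real \<Rightarrow> 'b::real_vector) \<Rightarrow> real \<Rightarrow> 'b" where
  "sign_mean b 0 h x = h x"
| "sign_mean b (Suc n) h x =
     (1 / 2) *\<^sub>R (sign_mean (\<lambda>m. b (Suc m)) n h (x + b 0) + sign_mean (\<lambda>m. b (Suc m)) n h (x - b 0))"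

text \<open>A sum over both halves does not see which half got which sign. By induction the block
  runs through all choices of signs once each, so every trace of \<open>\<sigma>\<close> disappears
  here.\<close>

lemma sum_dyadic_block_eq_sign_mean:
  fixes D :: "nat \<Rightarrow> nat \<Rightarrow> real"
  assumes step: "\<And>n k. k < 2 ^ n \<Longrightarrow>
    \<exists>e\<in>{-1, 1}. D (Suc n) (2 * k) = D n k + e * b n \<and> D (Suc n) (2 * k + 1) = D n k - e * b n"
    and k: "k < 2 ^ n"
  shows "(\<Sum>l\<in>{k * 2 ^ j..<(k + 1) * 2 ^ j}. h (D (n + j) l)) = (2 ^ j) *\<^sub>R sign_mean (\<lambda>m. b (n + m)) j h (D n k)"
  using k
proof (induction j arbitrary: n k)
  case 0
  then show ?case by simp
next
  case (Suc j)
  from step[OF Suc.prems] obtain e where e: "e \<in> {-1, 1}"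
    "D (Suc n) (2 * k) = D n k + e * b n" "D (Suc n) (2 * k + 1) = D n k - e * b n" by blast
  let ?m = "sign_mean (\<lambda>m. b (n + Suc m)) j h"
  have "{k * 2 ^ Suc j..<(k + 1) * 2 ^ Suc j} =
    {2 * k * 2 ^ j..<(2 * k + 1) * 2 ^ j} \<union> {(2 * k + 1) * 2 ^ j..<(2 * k + 1 + 1) * 2 ^ j}"
    by (subst ivl_disj_un_two(3)) (auto simp: algebra_simps)
  then have "(\<Sum>l\<in>{k * 2 ^ Suc j..<(k + 1) * 2 ^ Suc j}. h (D (n + Suc j) l))
    = (\<Sum>l\<in>{2 * k * 2 ^ j..<(2 * k + 1) * 2 ^ j}. h (D (Suc n + j) l))
    + (\<Sum>l\<in>{(2 * k + 1) * 2 ^ j..<(2 * k + 1 + 1) * 2 ^ j}. h (D (Suc n + j) l))"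
    by (simp only:) (subst sum.union_disjoint, auto)
  also have "\<dots> = (2 ^ j) *\<^sub>R (?m (D (Suc n) (2 * k)) + ?m (D (Suc n) (2 * k + 1)))"
    using Suc.prems by (subst (1 2) Suc.IH) (auto simp: scaleR_add_right)
  also have "?m (D (Suc n) (2 * k)) + ?m (D (Suc n) (2 * k + 1)) = ?m (D n k + b n) + ?m (D n k - b n)"
    using e by (auto simp: add.commute)
  finally show ?case by simp
qed

text \<open>A crude bound on the largest slope, which puts all normalised slopes into the range of
  \<open>Phi_rescaled\<close>.\<close>

lemma abs_dyadic_le_sum:
  fixes D :: "nat \<Rightarrow> nat \<Rightarrow> real"
  assumes step: "\<And>n k. k < 2 ^ n \<Longrightarrow>
    \<exists>e\<in>{-1, 1}. D (Suc n) (2 * k) = D n k + e * b n \<and> D (Suc n) (2 * k + 1) = D n k - e * b n"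
    and "D 0 0 = 0" and "k < 2 ^ n"
  shows "\<bar>D n k\<bar> \<le> (\<Sum>m<n. \<bar>b m\<bar>)"
  using assms(3)
proof (induction n arbitrary: k)
  case 0
  then show ?case using assms(2) by simp
next
  case (Suc n)
  have k2: "k div 2 < 2 ^ n" using Suc.prems by auto
  from step[OF this] obtain e where e: "e \<in> {-1, 1}"
    "D (Suc n) (2 * (k div 2)) = D n (k div 2) + e * b n" "D (Suc n) (2 * (k div 2) + 1) = D n (k div 2) - e * b n" by blast
  have "k = 2 * (k div 2) \<or> k = 2 * (k div 2) + 1" by presburger
  then have "D (Suc n) k = D n (k div 2) + e * b n \<or> D (Suc n) k = D n (k div 2) - e * b n"
    using e(2,3) by metis
  with Suc.IH[OF k2] e(1) show ?case by auto
qed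

text \<open>Since \<open>\<Phi>\<close> is nonnegative, the sums increase with \<open>t\<close>.
  They can therefore be squeezed between those at two neighbouring points of a fixed dyadic grid,
  which consist of whole blocks.\<close>

lemma has_dyadic_variation_linearI:
  assumes cont: "continuous_on {0..1} f" and nonneg: "\<And>x. 0 \<le> \<Phi> x"
    and block: "\<And>N k. k < 2 ^ N \<Longrightarrow>
      (\<lambda>j. \<Sum>l\<in>{k * 2 ^ j..<(k + 1) * 2 ^ j}. \<Phi> \<bar>f ((real l + 1) / 2 ^ (N + j)) - f (real l / 2 ^ (N + j))\<bar>)
        \<longlonglongrightarrow> c / 2 ^ N"
  shows "has_dyadic_variation \<Phi> f (\<lambda>t. c * t)"
  unfolding has_dyadic_variation_def
proof (intro conjI cont ballI)
  fix t :: real assume t: "t \<in> {0..1}"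
  define \<phi> where "\<phi> n l = \<Phi> \<bar>f ((real l + 1) / 2 ^ n) - f (real l / 2 ^ n)\<bar>" for n l
  have \<phi>: "\<phi> n l \<ge> 0" for n l by (simp add: \<phi>_def nonneg)
  define V where "V n = (\<Sum>l\<in>{..nat \<lfloor>t * 2 ^ n\<rfloor>} - {2 ^ n}. \<phi> n l)" for n
  have blk: "(\<lambda>j. \<Sum>l<i * 2 ^ j. \<phi> (N + j) l) \<longlonglongrightarrow> real i * (c / 2 ^ N)" if "i \<le> 2 ^ N" for i N
    using that
  proof (induction i)
    case (Suc i)
    have "(\<Sum>l<Suc i * 2 ^ j. \<phi> (N + j) l) =
       (\<Sum>l<i * 2 ^ j. \<phi> (N + j) l) + (\<Sum>l\<in>{i * 2 ^ j..<(i + 1) * 2 ^ j}. \<phi> (N + j) l)" for j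
    proof -
      have "{..<Suc i * 2 ^ j} = {..<i * 2 ^ j} \<union> {i * 2 ^ j..<(i + 1) * 2 ^ j}"
        by (subst ivl_disj_un_one(2)) simp_all
      then show ?thesis by (rule ssubst) (rule sum.union_disjoint; force)
    qed
    moreover have "(\<lambda>j. \<Sum>l\<in>{i * 2 ^ j..<(i + 1) * 2 ^ j}. \<phi> (N + j) l) \<longlonglongrightarrow> c / 2 ^ N"
      unfolding \<phi>_def using block[of i N] Suc.prems by simp
    moreover have "(\<lambda>j. \<Sum>l<i * 2 ^ j. \<phi> (N + j) l) \<longlonglongrightarrow> real i * (c / 2 ^ N)"
      using Suc.prems by (intro Suc.IH) simp
    moreover have "real (Suc i) * (c / 2 ^ N) = real i * (c / 2 ^ N) + c / 2 ^ N" by (simp add: algebra_simps add_divide_distrib)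
    ultimately show ?case by (simp only: tendsto_add)
  qed simp
  have c0: "c \<ge> 0"
  proof -
    have "(\<lambda>j. \<Sum>l<1 * 2 ^ j. \<phi> (0 + j) l) \<longlonglongrightarrow> real 1 * (c / 2 ^ 0)" by (rule blk) simp
    then show ?thesis by (intro LIMSEQ_le_const[of _ c 0]) (auto intro: sum_nonneg \<phi>)
  qed
  have "V \<longlonglongrightarrow> c * t"
  proof (rule tendstoI)
    fix e :: real assume e: "e > 0"
    \<comment> \<open>In the limit a block contributes \<open>c / 2 ^ N\<close>, the cost of
      replacing \<open>t\<close> by a grid point.\<close>
    obtain N where N: "c / 2 ^ N < e / 2"
    proof -
      have "(\<lambda>N. c * (1 / 2) ^ N) \<longlonglongrightarrow> c * 0" by (intro tendsto_intros) auto
      then have "\<forall>\<^sub>F N in sequentially. c * (1 / 2) ^ N < e / 2"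
        using e by (intro order_tendstoD(2)) auto
      then show ?thesis using that by (auto simp: eventually_sequentially power_one_over)
    qed
    define i where "i = nat \<lfloor>t * 2 ^ N\<rfloor>"
    have it: "real i \<le> t * 2 ^ N" "t * 2 ^ N < real i + 1"
      using t unfolding i_def by (auto simp: le_floor_iff)
    have i: "i \<le> 2 ^ N"
    proof -
      have "t * 2 ^ N \<le> 1 * 2 ^ N" using t by (intro mult_right_mono) auto
      with it have "real i \<le> 2 ^ N" by linarith
      then have "real i \<le> real (2 ^ N)" by simp
      then show ?thesis by (simp only: of_nat_le_iff)
    qed
    \<comment> \<open>For \<open>t = 1\<close> the index \<open>i + 1\<close> would leave the unit
      interval; the cap fits the removal of the index \<open>2 ^ n\<close> from the
      variation.\<close>
    define i' where "i' = min (i + 1) (2 ^ N)"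
    have i': "i' \<le> 2 ^ N" "real i' \<le> real i + 1" by (auto simp: i'_def)
    have lo: "(\<Sum>l<i * 2 ^ j. \<phi> (N + j) l) \<le> V (N + j)" for j
      unfolding V_def
    proof (rule sum_mono2)
      show "{..<i * 2 ^ j} \<subseteq> {..nat \<lfloor>t * 2 ^ (N + j)\<rfloor>} - {2 ^ (N + j)}"
      proof
        fix l assume "l \<in> {..<i * 2 ^ j}"
        then have l: "l < i * 2 ^ j" by simp
        have "real l \<le> real (i * 2 ^ j)" using l by (simp only: of_nat_le_iff)
        also have "\<dots> \<le> t * 2 ^ N * 2 ^ j" using it by simp
        finally have "l \<le> nat \<lfloor>t * 2 ^ (N + j)\<rfloor>" by (simp add: power_add le_nat_floor mult.assoc)
        moreover have "l < 2 ^ (N + j)" using l i by (auto simp: power_add intro: less_le_trans)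
        ultimately show "l \<in> {..nat \<lfloor>t * 2 ^ (N + j)\<rfloor>} - {2 ^ (N + j)}" by simp
      qed
    qed (auto simp: \<phi>)
    have hi: "V (N + j) \<le> (\<Sum>l<i' * 2 ^ j. \<phi> (N + j) l)" for j
      unfolding V_def
    proof (rule sum_mono2)
      show "{..nat \<lfloor>t * 2 ^ (N + j)\<rfloor>} - {2 ^ (N + j)} \<subseteq> {..<i' * 2 ^ j}"
      proof
        fix l assume l: "l \<in> {..nat \<lfloor>t * 2 ^ (N + j)\<rfloor>} - {2 ^ (N + j)}"
        have t0: "t * 2 ^ (N + j) \<ge> 0" using t by simp
        have "real l \<le> real (nat \<lfloor>t * 2 ^ (N + j)\<rfloor>)" using l by simp
        also have "\<dots> \<le> t * 2 ^ (N + j)" using t0 by simp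
        finally have lt: "real l \<le> t * 2 ^ N * 2 ^ j" by (simp add: power_add mult.assoc)
        also have "\<dots> < (real i + 1) * 2 ^ j" using it by simp
        finally have "real l < real ((i + 1) * 2 ^ j)" by (simp add: algebra_simps)
        then have 1: "l < (i + 1) * 2 ^ j" by (simp only: of_nat_less_iff)
        have "t * 2 ^ N * 2 ^ j \<le> 1 * 2 ^ N * 2 ^ j" using t by (intro mult_right_mono) auto
        with lt have "real l \<le> 1 * 2 ^ N * 2 ^ j" by (rule order_trans)
        then have "real l \<le> real (2 ^ (N + j))" by (simp add: power_add)
        then have "l \<le> 2 ^ (N + j)" by (simp only: of_nat_le_iff)
        with l have "l < 2 ^ N * 2 ^ j" by (auto simp: power_add)
        with 1 show "l \<in> {..<i' * 2 ^ j}" by (auto simp: i'_def min_def)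
      qed
    qed (auto simp: \<phi>)
    have "real i * (c / 2 ^ N) > c * t - e"
    proof -
      have "c / 2 ^ N * (t * 2 ^ N - 1) \<le> c / 2 ^ N * real i" using it c0 by (intro mult_left_mono) auto
      moreover have "c / 2 ^ N * (t * 2 ^ N - 1) = c * t - c / 2 ^ N" by (simp add: algebra_simps)
      ultimately show ?thesis using N e by (simp add: mult.commute)
    qed
    from order_tendstoD(1)[OF blk[OF i] this]
    have ev1: "\<forall>\<^sub>F j in sequentially. c * t - e < (\<Sum>l<i * 2 ^ j. \<phi> (N + j) l)" .
    have "real i' * (c / 2 ^ N) < c * t + e"
    proof -
      have "c / 2 ^ N * real i' \<le> c / 2 ^ N * (t * 2 ^ N + 1)" using it i' c0 by (intro mult_left_mono) auto
      moreover have "c / 2 ^ N * (t * 2 ^ N + 1) = c * t + c / 2 ^ N" by (simp add: algebra_simps)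
      ultimately show ?thesis using N e by (simp add: mult.commute)
    qed
    from order_tendstoD(2)[OF blk[OF i'(1)] this]
    have ev2: "\<forall>\<^sub>F j in sequentially. (\<Sum>l<i' * 2 ^ j. \<phi> (N + j) l) < c * t + e" .
    from ev1 ev2 have "\<forall>\<^sub>F j in sequentially. dist (V (j + N)) (c * t) < e"
    proof eventually_elim
      case (elim j)
      with lo[of j] hi[of j] show ?case by (simp add: dist_real_def add.commute abs_less_iff)
    qed
    then show "\<forall>\<^sub>F n in sequentially. dist (V n) (c * t) < e"
      by (subst (asm) eventually_sequentially_seg)
  qed
  then show "(\<lambda>n. \<Sum>k\<in>{..nat \<lfloor>t * 2 ^ n\<rfloor>} - {2 ^ n}. \<Phi> \<bar>f ((real k + 1) / 2 ^ n) - f (real k / 2 ^ n)\<bar>)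
    \<longlonglongrightarrow> c * t"
    by (simp add: V_def[abs_def] \<phi>_def)
qed

section \<open>Reduction to means over random signs\<close>

lemma sign_mean_le:
  fixes h :: "real \<Rightarrow> real"
  assumes "\<And>d. \<bar>d - x\<bar> \<le> (\<Sum>m<j. \<bar>b m\<bar>) \<Longrightarrow> h d \<le> B"
  shows "sign_mean b j h x \<le> B"
  using assms
proof (induction j arbitrary: b x)
  case (Suc j)
  have "sign_mean (\<lambda>m. b (Suc m)) j h (x + b 0) \<le> B" "sign_mean (\<lambda>m. b (Suc m)) j h (x - b 0) \<le> B"
    by (intro Suc.IH Suc.prems; simp add: sum.lessThan_Suc_shift del: sum.lessThan_Suc; linarith)+
  then show ?case by simp
qed simp

lemma Phi_nonneg: "0 \<le> Phi g q x"
  by (simp add: Phi_def)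

text \<open>Summing \<open>Phi_rescaled\<close> over a block turns the variation into the mean of
  the \<open>p\<close>-th powers, with an error governed by the mean of the \<open>2 * p\<close>-th
  powers. What remains, \<open>lim\<close> and \<open>bdd\<close>, concerns sign means alone and is
  the only place where the two cases differ in substance.\<close>

lemma has_dyadic_variation_signed_tent_seriesI:
  fixes \<alpha> :: "nat \<Rightarrow> real"
  defines "b \<equiv> \<lambda>n. 2 ^ n * \<alpha> n"
  assumes g: "regularly_varying g \<rho>" and q: "0 \<le> q" "q < 1" and p: "p = 1 / (1 - q)"
    and s: "\<And>m. dyadic_sign m (\<sigma> m)" and a: "summable (\<lambda>m. \<bar>\<alpha> m\<bar>)"
    and r: "\<And>n. r n = 2 powr (real n * q) * sqrt (g (real n))"
    and bsum: "\<forall>\<^sub>F n in sequentially. (\<Sum>m<n. \<bar>b m\<bar>) \<le> 2 * real n * r n"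
    and lim: "\<And>N x. (\<lambda>j. sign_mean (\<lambda>m. b (N + m)) j (\<lambda>d. \<bar>d / r (N + j)\<bar> powr p) x) \<longlonglongrightarrow> c"
    and bdd: "\<And>N x. \<exists>B. \<forall>\<^sub>F j in sequentially.
      sign_mean (\<lambda>m. b (N + m)) j (\<lambda>d. \<bar>d / r (N + j)\<bar> powr (2 * p)) x \<le> B"
  shows "has_dyadic_variation (Phi g q) (signed_tent_series \<alpha> \<sigma>) (\<lambda>t. c * t)"
proof (rule has_dyadic_variation_linearI)
  define f where "f = signed_tent_series \<alpha> \<sigma>"
  define D where "D = dyadic_slope f"
  show "continuous_on {0..1} (signed_tent_series \<alpha> \<sigma>)"
    by (rule continuous_on_signed_tent_series[OF s a])
  show "0 \<le> Phi g q x" for x by (rule Phi_nonneg)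
  have step: "\<exists>e\<in>{-1, 1}. D (Suc n) (2 * k) = D n k + e * b n \<and> D (Suc n) (2 * k + 1) = D n k - e * b n"
    if "k < 2 ^ n" for n k
    using dyadic_slope_signed_tent_series_Suc[OF s a that] by (simp add: D_def f_def b_def)
  have D0: "D 0 0 = 0" by (simp add: D_def f_def dyadic_slope_signed_tent_series_0)
  have rpos: "r n > 0" for n using g by (simp add: r regularly_varying_def)
  fix N k :: nat assume k: "k < 2 ^ N"
  define x where "x = D N k"
  define I where "I j = {k * 2 ^ j..<(k + 1) * 2 ^ j}" for j
  define V where "V j = (\<Sum>l\<in>I j. Phi g q \<bar>f ((real l + 1) / 2 ^ (N + j)) - f (real l / 2 ^ (N + j))\<bar>)" for j
  define A where "A j = sign_mean (\<lambda>m. b (N + m)) j (\<lambda>d. \<bar>d / r (N + j)\<bar> powr p) x" for j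
  define A2 where "A2 j = sign_mean (\<lambda>m. b (N + m)) j (\<lambda>d. \<bar>d / r (N + j)\<bar> powr (2 * p)) x" for j
  obtain B where B: "\<forall>\<^sub>F j in sequentially. A2 j \<le> B" using bdd unfolding A2_def by blast
  define B' where "B' = max B 0"
  have cardI: "card (I j) = 2 ^ j" for j by (simp add: I_def)
  have IlN: "l < 2 ^ (N + j)" if "l \<in> I j" for l j
  proof -
    have "l < (k + 1) * 2 ^ j" using that by (simp add: I_def)
    also have "\<dots> \<le> 2 ^ N * 2 ^ j" using k by (intro mult_right_mono) auto
    finally show ?thesis by (simp add: power_add)
  qed
  have blk: "(\<Sum>l\<in>I j. h (D (N + j) l)) = 2 ^ j * sign_mean (\<lambda>m. b (N + m)) j h x" for h :: "real \<Rightarrow> real" and j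
    unfolding I_def x_def using sum_dyadic_block_eq_sign_mean[of D b k N h j, OF step k] by simp
  have "(\<lambda>j. V j - A j / 2 ^ N) \<longlonglongrightarrow> 0"
  proof (rule tendstoI)
    fix e :: real assume e: "e > 0"
    \<comment> \<open>The error over a block adds up to at most
      \<open>2 ^ j * (e' * (1 + B'))\<close>, to be compared with \<open>2 ^ n * e\<close>.\<close>
    define e' where "e' = e / 2 / (1 + B')"
    have B'0: "1 + B' > 0" by (simp add: B'_def)
    then have "e' * (1 + B') = e / 2" by (intro iffD1[OF nonzero_eq_divide_eq e'_def]) simp
    moreover have "e' > 0" using e B'0 by (simp add: e'_def)
    ultimately have e': "e' > 0" "e' * (1 + B') < e" using e by simp_all
    have "\<forall>\<^sub>F n in sequentially. (\<forall>w. 0 \<le> w \<and> w \<le> 2 * real n \<longrightarrow>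
      \<bar>2 ^ n * Phi g q (2 powr (- (real n * (1 - q))) * sqrt (g (real n)) * w) - w powr p\<bar>
      \<le> e' * (1 + w powr (2 * p))) \<and> (\<Sum>m<n. \<bar>b m\<bar>) \<le> 2 * real n * r n"
      using Phi_rescaled[OF g q p e'(1)] bsum by eventually_elim auto
    then have "\<forall>\<^sub>F j in sequentially. (\<forall>w. 0 \<le> w \<and> w \<le> 2 * real (N + j) \<longrightarrow>
      \<bar>2 ^ (N + j) * Phi g q (2 powr (- (real (N + j) * (1 - q))) * sqrt (g (real (N + j))) * w) - w powr p\<bar>
      \<le> e' * (1 + w powr (2 * p))) \<and> (\<Sum>m<N + j. \<bar>b m\<bar>) \<le> 2 * real (N + j) * r (N + j)"
      by (subst (asm) eventually_sequentially_seg[of _ N, symmetric]) (simp only: add.commute[of _ N])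
    with B show "\<forall>\<^sub>F j in sequentially. dist (V j - A j / 2 ^ N) 0 < e"
    proof eventually_elim
      case (elim j)
      define n where "n = N + j"
      define w where "w l = \<bar>D n l / r n\<bar>" for l
      have est: "\<bar>2 ^ n * Phi g q \<bar>f ((real l + 1) / 2 ^ n) - f (real l / 2 ^ n)\<bar> - w l powr p\<bar>
         \<le> e' * (1 + w l powr (2 * p))" if l: "l \<in> I j" for l
      proof -
        have "\<bar>D n l\<bar> \<le> (\<Sum>m<n. \<bar>b m\<bar>)"
          by (rule abs_dyadic_le_sum[OF step D0]) (use IlN[OF l] in \<open>auto simp: n_def\<close>)
        also have "\<dots> \<le> 2 * real n * r n" using elim by (simp add: n_def)
        finally have w: "0 \<le> w l" "w l \<le> 2 * real n" using rpos[of n] by (auto simp: w_def field_simps abs_divide)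
        have "\<bar>f ((real l + 1) / 2 ^ n) - f (real l / 2 ^ n)\<bar> = \<bar>D n l\<bar> / 2 ^ n"
          by (simp add: D_def dyadic_slope_def abs_mult)
        also have "\<dots> = (1 / 2 ^ n) * r n * w l" using rpos[of n] by (simp add: w_def abs_divide)
        also have "(1 / 2 ^ n) * r n = 2 powr (- (real n * (1 - q))) * sqrt (g (real n))"
          by (simp add: r right_diff_distrib powr_diff powr_realpow)
        finally show ?thesis using elim w unfolding n_def[symmetric] by simp
      qed
      \<comment> \<open>As \<open>n = N + j\<close>, the factor \<open>2 ^ n / 2 ^ N\<close> is the
        number of intervals in the block, which turns the mean \<open>A j\<close> into a
        sum.\<close>
      have "2 ^ n * (V j - A j / 2 ^ N) = (\<Sum>l\<in>I j. 2 ^ n * Phi g q \<bar>f ((real l + 1) / 2 ^ n) - f (real l / 2 ^ n)\<bar> - w l powr p)"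
      proof -
        have "(\<Sum>l\<in>I j. w l powr p) = 2 ^ j * A j"
          using blk[of "\<lambda>d. \<bar>d / r (N + j)\<bar> powr p" j] by (simp add: w_def A_def n_def)
        then show ?thesis
          by (simp add: sum_subtractf sum_distrib_left[symmetric] V_def n_def right_diff_distrib power_add)
      qed
      also have "\<bar>\<dots>\<bar> \<le> (\<Sum>l\<in>I j. e' * (1 + w l powr (2 * p)))"
        by (rule order_trans[OF sum_abs sum_mono[OF est]])
      also have "\<dots> = e' * (2 ^ j + 2 ^ j * A2 j)"
        using blk[of "\<lambda>d. \<bar>d / r (N + j)\<bar> powr (2 * p)" j]
        by (simp add: sum_distrib_left[symmetric] sum.distrib cardI w_def A2_def n_def)
      also have "\<dots> \<le> e' * (2 ^ j + 2 ^ j * B')"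
        using elim e' by (intro mult_left_mono add_mono) (auto simp: B'_def)
      also have "\<dots> = 2 ^ j * (e' * (1 + B'))" by (simp add: algebra_simps)
      also have "\<dots> < 2 ^ j * e" using e' by simp
      also have "\<dots> \<le> 2 ^ n * e" using e by (intro mult_right_mono power_increasing) (auto simp: n_def)
      finally have "\<bar>2 ^ n * (V j - A j / 2 ^ N)\<bar> < 2 ^ n * e" .
      then show ?case by (simp add: dist_real_def abs_mult)
    qed
  qed
  moreover have "(\<lambda>j. A j / 2 ^ N) \<longlonglongrightarrow> c / 2 ^ N"
    unfolding A_def by (intro tendsto_intros lim) auto
  ultimately have "V \<longlonglongrightarrow> c / 2 ^ N" using tendsto_add by fastforce
  then show "(\<lambda>j. \<Sum>l\<in>{k * 2 ^ j..<(k + 1) * 2 ^ j}. Phi g q \<bar>signed_tent_series \<alpha> \<sigma> ((real l + 1) / 2 ^ (N + j))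
      - signed_tent_series \<alpha> \<sigma> (real l / 2 ^ (N + j))\<bar>) \<longlonglongrightarrow> c / 2 ^ N"
    by (simp add: V_def[abs_def] I_def f_def)
qed

section \<open>Means over signs as expectations\<close>

context prob_space
begin

lemma expectation_bounded_fun_integrable:
  fixes h :: "real \<Rightarrow> real"
  assumes h: "continuous_on UNIV h" and S: "S \<in> borel_measurable M" and B: "\<And>\<omega>. \<omega> \<in> space M \<Longrightarrow> \<bar>S \<omega>\<bar> \<le> B"
  shows "integrable M (\<lambda>\<omega>. h (S \<omega>))"
proof -
  have "bounded (h ` {-B..B})"
    by (intro compact_imp_bounded compact_continuous_image continuous_on_subset[OF h]) auto
  then obtain C where "\<forall>y\<in>{-B..B}. \<bar>h y\<bar> \<le> C" by (auto simp: bounded_iff)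
  then have C: "\<bar>h y\<bar> \<le> C" if "y \<in> {-B..B}" for y using that by blast
  show ?thesis
  proof (rule integrable_const_bound[of _ C])
    show "AE \<omega> in M. norm (h (S \<omega>)) \<le> C"
    proof (rule AE_I2)
      fix \<omega> assume "\<omega> \<in> space M"
      from B[OF this] have "S \<omega> \<in> {-B..B}" by auto
      then show "norm (h (S \<omega>)) \<le> C" using C by simp
    qed
    show "(\<lambda>\<omega>. h (S \<omega>)) \<in> borel_measurable M"
      by (rule measurable_compose[OF S borel_measurable_continuous_onI[OF h]])
  qed
qed

text \<open>The order of the signs does not affect the law, but it decides about pointwise
  convergence: with \<open>Y (j - m)\<close> at position \<open>m\<close>, the most recent levels
  keep their variables as \<open>j\<close> grows. The induction splits off \<open>Y (Suc j)\<close>,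
  the sign of the first position, which is independent of all others.\<close>

lemma sign_mean_eq_expectation:
  fixes h :: "real \<Rightarrow> real"
  assumes indep: "indep_vars (\<lambda>_. borel) Y {1..}"
    and Y: "\<And>m. m \<ge> 1 \<Longrightarrow> symmetric_bernoulli M (Y m)"
    and h: "continuous_on UNIV h"
  shows "sign_mean b j h x = expectation (\<lambda>\<omega>. h (x + (\<Sum>m<j. b m * Y (j - m) \<omega>)))"
proof (induction j arbitrary: b x)
  case 0
  then show ?case by (simp add: prob_space)
next
  case (Suc j)
  define S where "S \<omega> = (\<Sum>m<j. b (Suc m) * Y (j - m) \<omega>)" for \<omega>
  have Ym: "Y m \<in> borel_measurable M" if "m \<ge> 1" for m
    using Y[OF that] by (simp add: symmetric_bernoulli_def)
  have Yv: "Y m \<omega> \<in> {-1, 1}" if "m \<ge> 1" "\<omega> \<in> space M" for m \<omega>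
    using Y[OF that(1)] that(2) by (simp add: symmetric_bernoulli_def)
  \<comment> \<open>The sign split off and the weighted others form one independent family, so that
    \<open>indep_vars_sum\<close> separates the former from the sum of the latter. Position
    \<open>m\<close> of the tail carries \<open>i = j - m\<close>, hence the weight
    \<open>b (Suc (j - i))\<close>.\<close>
  define X where "X i \<omega> = (if i = Suc j then Y i \<omega> else b (Suc (j - i)) * Y i \<omega>)" for i \<omega>
  have "indep_vars (\<lambda>_. borel) (\<lambda>i \<omega>. (\<lambda>y. if i = Suc j then y else b (Suc (j - i)) * y) (Y i \<omega>)) {1..}"
    by (rule indep_vars_compose2[OF indep]) auto
  then have "indep_vars (\<lambda>_. borel) X (insert (Suc j) {1..j})"
    unfolding X_def[abs_def] by (rule indep_vars_subset) auto
  from indep_vars_sum[OF _ _ this]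
  have "indep_var borel (X (Suc j)) borel (\<lambda>\<omega>. \<Sum>i\<in>{1..j}. X i \<omega>)" by simp
  moreover have "X (Suc j) = Y (Suc j)" by (simp add: X_def fun_eq_iff)
  moreover have "(\<Sum>i\<in>{1..j}. X i \<omega>) = S \<omega>" for \<omega>
    unfolding S_def
    by (rule sum.reindex_bij_witness[of _ "\<lambda>m. j - m" "\<lambda>i. j - i"]) (auto simp: X_def)
  ultimately have ind: "indep_var borel (Y (Suc j)) borel S" by simp
  have Sm [measurable]: "S \<in> borel_measurable M"
    unfolding S_def[abs_def] by (intro borel_measurable_sum borel_measurable_times Ym) auto
  have SB: "\<bar>S \<omega>\<bar> \<le> (\<Sum>m<j. \<bar>b (Suc m)\<bar>)" if "\<omega> \<in> space M" for \<omega>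
    unfolding S_def
  proof (rule order_trans[OF sum_abs sum_mono])
    fix m assume "m \<in> {..<j}"
    then have "Y (j - m) \<omega> \<in> {-1, 1}" using that by (intro Yv) auto
    then show "\<bar>b (Suc m) * Y (j - m) \<omega>\<bar> \<le> \<bar>b (Suc m)\<bar>" by (auto simp: abs_mult)
  qed
  have int: "integrable M (\<lambda>\<omega>. h (y + S \<omega>))" for y
    by (rule expectation_bounded_fun_integrable[OF continuous_on_compose2[OF h] Sm SB])
      (auto intro!: continuous_intros)
  have hm: "(\<lambda>z. h (y + z)) \<in> borel_measurable borel" for y
    by (rule borel_measurable_continuous_onI, rule continuous_on_compose2[OF h]) (auto intro!: continuous_intros)
  \<comment> \<open>Independence lets the event that the sign equals \<open>s\<close> factor out
    with its probability 1/2.\<close>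
  have half: "integrable M (\<lambda>\<omega>. indicator {s} (Y (Suc j) \<omega>) * h (y + S \<omega>))"
     "expectation (\<lambda>\<omega>. indicator {s} (Y (Suc j) \<omega>) * h (y + S \<omega>)) = (1 / 2) * expectation (\<lambda>\<omega>. h (y + S \<omega>))"
    if s: "s \<in> {-1, 1}" for s y :: real
  proof -
    have i: "indep_var borel (\<lambda>\<omega>. indicator {s} (Y (Suc j) \<omega>) :: real) borel (\<lambda>\<omega>. h (y + S \<omega>))"
      using indep_var_compose[OF ind, of "indicator {s}" borel "\<lambda>z. h (y + z)" borel] hm
      by (simp add: comp_def)
    have m: "{\<omega> \<in> space M. Y (Suc j) \<omega> = s} \<in> events"
      using Ym[of "Suc j"] by measurable
    have "expectation (\<lambda>\<omega>. indicator {s} (Y (Suc j) \<omega>) :: real) = expectation (indicator {\<omega> \<in> space M. Y (Suc j) \<omega> = s})"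
      by (rule Bochner_Integration.integral_cong) (auto simp: indicator_def)
    also have "\<dots> = 1 / 2"
      using m Y[of "Suc j"] s by (auto simp: symmetric_bernoulli_def)
    finally have e: "expectation (\<lambda>\<omega>. indicator {s} (Y (Suc j) \<omega>) :: real) = 1 / 2" .
    have ii: "integrable M (\<lambda>\<omega>. indicator {s} (Y (Suc j) \<omega>) :: real)"
      by (rule integrable_const_bound[of _ 1])
        (auto simp: indicator_def intro!: measurable_compose[OF Ym[of "Suc j"]])
    show "integrable M (\<lambda>\<omega>. indicator {s} (Y (Suc j) \<omega>) * h (y + S \<omega>))"
      by (rule indep_var_integrable[OF i ii int])
    show "expectation (\<lambda>\<omega>. indicator {s} (Y (Suc j) \<omega>) * h (y + S \<omega>)) = (1 / 2) * expectation (\<lambda>\<omega>. h (y + S \<omega>))"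
      using indep_var_lebesgue_integral[OF i ii int] e by simp
  qed
  have "expectation (\<lambda>\<omega>. h (x + (\<Sum>m<Suc j. b m * Y (Suc j - m) \<omega>)))
     = expectation (\<lambda>\<omega>. indicator {1} (Y (Suc j) \<omega>) * h (x + b 0 + S \<omega>)
          + indicator {-1} (Y (Suc j) \<omega>) * h (x - b 0 + S \<omega>))"
  proof (rule Bochner_Integration.integral_cong)
    fix \<omega> assume "\<omega> \<in> space M"
    then have "Y (Suc j) \<omega> \<in> {-1, 1}" by (intro Yv) auto
    then show "h (x + (\<Sum>m<Suc j. b m * Y (Suc j - m) \<omega>)) =
      indicator {1} (Y (Suc j) \<omega>) * h (x + b 0 + S \<omega>) + indicator {-1} (Y (Suc j) \<omega>) * h (x - b 0 + S \<omega>)"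
      unfolding S_def by (auto simp: sum.lessThan_Suc_shift algebra_simps simp del: sum.lessThan_Suc)
  qed simp
  also have "\<dots> = (1 / 2) * expectation (\<lambda>\<omega>. h (x + b 0 + S \<omega>)) + (1 / 2) * expectation (\<lambda>\<omega>. h (x - b 0 + S \<omega>))"
    by (subst Bochner_Integration.integral_add) (auto simp: half)
  also have "\<dots> = sign_mean b (Suc j) h x" by (simp add: Suc.IH S_def)
  finally show ?case ..
qed

end

section \<open>The case of positive \<open>q\<close>\<close>

lemma tendsto_diff_shift:
  fixes a :: "nat \<Rightarrow> real"
  assumes "(\<lambda>n. a (Suc n) - a n) \<longlonglongrightarrow> 0"
  shows "(\<lambda>n. a (n + l) - a n) \<longlonglongrightarrow> 0"
proof (induction l)
  case (Suc l)
  have "(\<lambda>n. (a (Suc (n + l)) - a (n + l)) + (a (n + l) - a n)) \<longlonglongrightarrow> 0 + 0"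
    by (intro tendsto_add Suc LIMSEQ_ignore_initial_segment[OF assms])
  then show ?case by simp
qed simp

lemma half_ln_Suc:
  assumes "regularly_varying g \<rho>"
  shows "(\<lambda>n. ln (g (real (Suc n))) / 2 - ln (g (real n)) / 2) \<longlonglongrightarrow> 0"
  using tendsto_divide[OF regularly_varying_ln_Suc[OF assms] tendsto_const[of 2]]
  by (simp add: diff_divide_distrib)

lemma sqrt_eq_exp_half_ln: "x > 0 \<Longrightarrow> sqrt x = exp (ln x / 2)" for x :: real
  by (simp add: powr_half_sqrt[symmetric] powr_def)

text \<open>Half of the geometric decay absorbs the growth of \<open>sqrt (g m)\<close>, the other
  half makes the series converge. The factor \<open>K\<close> covers \<open>coeff_a\<close> and
  \<open>coeff_b\<close> alike.\<close>

lemma summable_tent_coefficients: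
  assumes g: "regularly_varying g \<rho>" and q: "q < 1" and K: "K \<ge> 0"
  shows "summable (\<lambda>m. \<bar>2 powr (- (real m * (1 - q))) * sqrt (K * g (real m))\<bar>)"
proof -
  define a where "a n = ln (g (real n)) / 2" for n
  have sqrt_g: "sqrt (g (real n)) = exp (a n)" for n
    unfolding a_def using g by (intro sqrt_eq_exp_half_ln) (simp add: regularly_varying_def)
  define e where "e = (1 - q) * ln 2 / 2"
  have e: "e > 0" using q by (simp add: e_def)
  obtain C where C': "\<forall>r l. \<bar>a (r + l) - a r\<bar> \<le> C + e * real l"
    using subexponential_growth[of a e] half_ln_Suc[OF g] e by (auto simp: a_def)
  have C: "a l \<le> a 0 + C + e * real l" for l
    using C'[rule_format, of 0 l] by simp
  show ?thesis
  proof (rule summable_comparison_test'[where N = 0])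
    show "summable (\<lambda>m. sqrt K * exp (a 0 + C) * exp (- e) ^ m)"
      using e by (intro summable_mult summable_geometric) simp
    fix m :: nat
    have "2 powr (- (real m * (1 - q))) = exp (- (2 * e * real m))" by (simp add: powr_def e_def mult_ac)
    then have "2 powr (- (real m * (1 - q))) * exp (a m) = exp (a m - 2 * e * real m)"
      by (simp only: exp_add[symmetric]) simp
    also have "\<dots> \<le> exp (a 0 + C + real m * (- e))" using C[of m] by simp
    also have "\<dots> = exp (a 0 + C) * exp (- e) ^ m" unfolding exp_add[of "a 0 + C"] exp_of_nat_mult ..
    finally have "sqrt K * (2 powr (- (real m * (1 - q))) * exp (a m)) \<le> sqrt K * (exp (a 0 + C) * exp (- e) ^ m)"
      using K by (intro mult_left_mono) auto
    then show "norm \<bar>2 powr (- (real m * (1 - q))) * sqrt (K * g (real m))\<bar> \<le> sqrt K * exp (a 0 + C) * exp (- e) ^ m"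
      using K by (simp add: real_sqrt_mult sqrt_g abs_mult mult_ac)
  qed
qed

text \<open>Against the normalisation \<open>l\<close> levels later, a weight tends to the
  coefficient of \<open>Y l\<close> in \<open>Z_var\<close> and is dominated by a summable
  \<open>B l\<close>, uniformly in the level. Hence the normalised slopes are uniformly bounded,
  which settles the moments, and Tannery's theorem followed by dominated convergence identifies the
  limit.\<close>

lemma (in prob_space) has_dyadic_variation_coeff_a:
  assumes g: "regularly_varying g \<rho>" and q: "0 < q" "q < 1"
    and s: "\<And>m. dyadic_sign m (\<sigma> m)"
    and indep: "indep_vars (\<lambda>_. borel) Y {1..}"
    and Y: "\<And>m. m \<ge> 1 \<Longrightarrow> symmetric_bernoulli M (Y m)"
  shows "has_dyadic_variation (Phi g q) (signed_tent_series (coeff_a g q) \<sigma>)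
    (\<lambda>t. expectation (\<lambda>\<omega>. \<bar>Z_var q Y \<omega>\<bar> powr (1 / (1 - q))) * t)"
proof -
  define p where "p = 1 / (1 - q)"
  have p: "p > 0" using q by (simp add: p_def)
  define K where "K = 2 powr (2 * q) - 1"
  have K: "K > 0" using q by (simp add: K_def)
  define a where "a n = ln (g (real n)) / 2" for n
  have sqrt_g: "sqrt (g (real n)) = exp (a n)" for n
    unfolding a_def using g by (intro sqrt_eq_exp_half_ln) (simp add: regularly_varying_def)
  have a: "(\<lambda>n. a (Suc n) - a n) \<longlonglongrightarrow> 0" unfolding a_def by (rule half_ln_Suc[OF g])
  define r where "r n = 2 powr (real n * q) * sqrt (g (real n))" for n
  define b where "b n = 2 ^ n * coeff_a g q n" for n
  have r: "r n > 0" for n using g by (simp add: r_def regularly_varying_def)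
  have b_eq: "b n = 2 powr (real n * q) * sqrt K * exp (a n)" for n
    using K by (simp add: b_def coeff_a_def K_def[symmetric] real_sqrt_mult sqrt_g right_diff_distrib
        powr_diff powr_realpow)
  have b: "b n > 0" for n using K by (simp add: b_eq)
  have r_eq: "r n = 2 powr (real n * q) * exp (a n)" for n by (simp add: r_def sqrt_g)
  have ratio: "b m / r (m + l) = sqrt K * 2 powr (- (q * real l)) * exp (- (a (m + l) - a m))" for m l
    by (simp add: b_eq r_eq exp_diff powr_add powr_minus distrib_left distrib_right divide_simps mult_ac)
  \<comment> \<open>Half the decay rate of \<open>2 powr (- (q * l))\<close>; the other half is
    spent on the fluctuation of \<open>g\<close>.\<close>
  define e where "e = q * ln 2 / 2"
  have e: "e > 0" using q by (simp add: e_def)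
  obtain C where C: "\<And>r l. \<bar>a (r + l) - a r\<bar> \<le> C + e * real l"
    using subexponential_growth[OF a e] by metis
  define B where "B l = sqrt K * exp C * exp (- e) ^ l" for l
  have B: "summable B" unfolding B_def using e by (intro summable_mult summable_geometric) simp
  have B_nonneg: "B l \<ge> 0" for l using K by (simp add: B_def)
  have ratio_le: "b m / r (m + l) \<le> B l" for m l
  proof -
    have "2 powr (- (q * real l)) = exp (- (2 * e * real l))" by (simp add: powr_def e_def mult_ac)
    then have "2 powr (- (q * real l)) * exp (- (a (m + l) - a m)) = exp (- (2 * e * real l) - (a (m + l) - a m))"
      by (simp only: exp_add[symmetric]) simp
    also have "\<dots> \<le> exp (C + real l * (- e))" using C[of m l] by simp
    also have "\<dots> = exp C * exp (- e) ^ l" unfolding exp_add exp_of_nat_mult ..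
    finally have "sqrt K * (2 powr (- (q * real l)) * exp (- (a (m + l) - a m))) \<le> sqrt K * (exp C * exp (- e) ^ l)"
      using K by (intro mult_left_mono) auto
    then show ?thesis unfolding ratio B_def by (simp only: mult.assoc)
  qed
  \<comment> \<open>Seen from level \<open>N + j\<close>, the latest weight has lag 1, hence the
    shift, which agrees with the first index of the series for \<open>Z\<close>.\<close>
  define W where "W = (\<Sum>l. B (Suc l))"
  have BS: "summable (\<lambda>l. B (Suc l))" using B by (simp add: summable_Suc_iff)
  have block_le: "(\<Sum>m<j. \<bar>b (N + m)\<bar>) / r (N + j) \<le> W" for N j
  proof -
    have "(\<Sum>m<j. \<bar>b (N + m)\<bar>) / r (N + j) = (\<Sum>m<j. b (N + m) / r (N + j))"
      using b by (simp add: sum_divide_distrib less_imp_le)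
    also have "\<dots> = (\<Sum>i<j. b (N + (j - Suc i)) / r (N + j))"
      by (rule sum.nat_diff_reindex[symmetric])
    also have "\<dots> \<le> (\<Sum>i<j. B (Suc i))"
    proof (rule sum_mono)
      fix i assume "i \<in> {..<j}"
      then have "N + j = N + (j - Suc i) + Suc i" by simp
      then show "b (N + (j - Suc i)) / r (N + j) \<le> B (Suc i)" by (metis ratio_le)
    qed
    also have "\<dots> \<le> W" unfolding W_def by (rule sum_le_suminf[OF BS]) (auto intro: B_nonneg)
    finally show ?thesis .
  qed
  \<comment> \<open>The case \<open>m = 0\<close> of \<open>ratio_le\<close> doubles as exponential
    growth of \<open>r\<close>, which makes the starting slope \<open>x\<close> disappear in the
    limit.\<close>
  have inv_r: "1 / r n \<le> B n / b 0" for n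
    using ratio_le[of 0 n] b[of 0] r[of n] by (simp add: field_simps)
  have value_le: "\<bar>d / r (N + j)\<bar> \<le> \<bar>x\<bar> * (B 0 / b 0) + W"
    if "\<bar>d - x\<bar> \<le> (\<Sum>m<j. \<bar>b (N + m)\<bar>)" for d x N j
  proof -
    have "\<bar>d / r (N + j)\<bar> \<le> (\<bar>x\<bar> + (\<Sum>m<j. \<bar>b (N + m)\<bar>)) / r (N + j)"
      unfolding abs_divide using that r[of "N + j"] by (simp add: divide_right_mono)
    also have "\<dots> = \<bar>x\<bar> * (1 / r (N + j)) + (\<Sum>m<j. \<bar>b (N + m)\<bar>) / r (N + j)"
      by (simp add: add_divide_distrib)
    also have "\<dots> \<le> \<bar>x\<bar> * (B 0 / b 0) + W"
    proof (intro add_mono block_le mult_left_mono order_trans[OF inv_r] divide_right_mono)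
      have "exp (- e) ^ (N + j) \<le> 1" using e by (intro power_le_one) auto
      then show "B (N + j) \<le> B 0" using K by (simp add: B_def mult_left_le)
    qed (use b[of 0] in auto)
    finally show ?thesis .
  qed
  have Ym: "Y m \<in> borel_measurable M" if "m \<ge> 1" for m
    using Y[OF that] by (simp add: symmetric_bernoulli_def)
  have Yv: "Y m \<omega> \<in> {-1, 1}" if "m \<ge> 1" "\<omega> \<in> space M" for m \<omega>
    using Y[OF that(1)] that(2) by (simp add: symmetric_bernoulli_def)
  define T where "T N x j \<omega> = (x + (\<Sum>m<j. b (N + m) * Y (j - m) \<omega>)) / r (N + j)" for N x j \<omega>
  have T_lim: "(\<lambda>j. T N x j \<omega>) \<longlonglongrightarrow> Z_var q Y \<omega>" if \<omega>: "\<omega> \<in> space M" for N x \<omega>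
  proof -
    \<comment> \<open>The contribution of lag \<open>Suc i\<close>, with default 0 for lags beyond
      \<open>j\<close>: all sums become series over one index set, as Tannery's theorem
      requires.\<close>
    define c where "c i j = (if i < j then b (N + (j - Suc i)) / r (N + j) * Y (Suc i) \<omega> else 0)" for i j
    define c' where "c' i = sqrt K * (2 powr (- (q * real (Suc i))) * Y (Suc i) \<omega>)" for i
    have T_eq: "T N x j \<omega> = x / r (N + j) + (\<Sum>i. c i j)" for j
    proof -
      have "(\<Sum>i. c i j) = (\<Sum>i<j. c i j)" by (rule suminf_finite) (auto simp: c_def)
      also have "\<dots> = (\<Sum>i<j. b (N + (j - Suc i)) * Y (j - (j - Suc i)) \<omega> / r (N + j))"
        by (rule sum.cong) (auto simp: c_def Suc_diff_Suc)
      also have "\<dots> = (\<Sum>m<j. b (N + m) * Y (j - m) \<omega> / r (N + j))"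
        by (rule sum.nat_diff_reindex[of "\<lambda>m. b (N + m) * Y (j - m) \<omega> / r (N + j)" j])
      finally show ?thesis by (simp add: T_def sum_divide_distrib add_divide_distrib)
    qed
    have "(\<forall>\<^sub>F j in sequentially. summable (\<lambda>i. norm (c i j))) \<and> summable (\<lambda>i. norm (c' i)) \<and>
      (\<lambda>j. \<Sum>i. c i j) \<longlonglongrightarrow> suminf c'"
    proof (rule tannerys_theorem[where M = "\<lambda>i. B (Suc i)"])
      fix i
      show "(\<lambda>j. c i j) \<longlonglongrightarrow> c' i"
      proof (rule LIMSEQ_offset[of _ "Suc i"])
        have "(\<lambda>j. sqrt K * 2 powr (- (q * real (Suc i))) * exp (- (a (j + N + Suc i) - a (j + N))) * Y (Suc i) \<omega>)
          \<longlonglongrightarrow> sqrt K * 2 powr (- (q * real (Suc i))) * exp (- 0) * Y (Suc i) \<omega>"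
          by (intro tendsto_intros LIMSEQ_ignore_initial_segment[OF tendsto_diff_shift[OF a]])
        also have "(\<lambda>j. sqrt K * 2 powr (- (q * real (Suc i))) * exp (- (a (j + N + Suc i) - a (j + N))) * Y (Suc i) \<omega>)
          = (\<lambda>j. c i (j + Suc i))"
          unfolding ratio[symmetric] by (simp add: c_def ac_simps)
        finally show "(\<lambda>j. c i (j + Suc i)) \<longlonglongrightarrow> c' i" by (simp add: c'_def mult.assoc)
      qed
    next
      show "\<forall>\<^sub>F (i, j) in at_top \<times>\<^sub>F sequentially. norm (c i j) \<le> B (Suc i)"
      proof (intro always_eventually allI, clarify)
        fix i j
        have "\<bar>Y (Suc i) \<omega>\<bar> = 1" using Yv[of "Suc i" \<omega>] \<omega> by auto
        moreover have "b (N + (j - Suc i)) / r (N + j) \<le> B (Suc i)" if "i < j"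
          using ratio_le[of "N + (j - Suc i)" "Suc i"] that by simp
        ultimately show "norm (c i j) \<le> B (Suc i)"
          using B_nonneg[of "Suc i"] b[of "N + j - Suc i"] r[of "N + j"] by (simp add: c_def abs_mult)
      qed
    qed (use BS in auto)
    moreover have "suminf c' = Z_var q Y \<omega>"
      unfolding c'_def Z_var_def K_def[symmetric]
    proof (rule suminf_mult)
      have "summable (\<lambda>i. 2 powr (- q) * (2 powr (- q)) ^ i)"
        using q by (intro summable_mult summable_geometric) (simp add: powr_minus inverse_eq_divide)
      then show "summable (\<lambda>i. 2 powr (- (q * real (Suc i))) * Y (Suc i) \<omega>)"
      proof (rule summable_comparison_test'[where N = 0])
        fix i
        have "\<bar>Y (Suc i) \<omega>\<bar> = 1" using Yv[of "Suc i" \<omega>] \<omega> by auto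
        then show "norm (2 powr (- (q * real (Suc i))) * Y (Suc i) \<omega>) \<le> 2 powr (- q) * (2 powr (- q)) ^ i"
          by (simp add: abs_mult powr_power powr_add[symmetric] algebra_simps)
      qed
    qed
    moreover have "(\<lambda>j. x / r (N + j)) \<longlonglongrightarrow> 0"
    proof (rule tendsto_rabs_zero_cancel, rule tendsto_sandwich[of "\<lambda>_. 0" _ _ "\<lambda>j. \<bar>x\<bar> * (B (j + N) / b 0)"])
      have "B \<longlonglongrightarrow> 0" by (rule summable_LIMSEQ_zero[OF B])
      then have "(\<lambda>j. \<bar>x\<bar> * (B (j + N) / b 0)) \<longlonglongrightarrow> \<bar>x\<bar> * (0 / b 0)"
        using b[of 0] by (intro tendsto_intros LIMSEQ_ignore_initial_segment) auto
      then show "(\<lambda>j. \<bar>x\<bar> * (B (j + N) / b 0)) \<longlonglongrightarrow> 0" by simp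
      show "\<forall>\<^sub>F j in sequentially. \<bar>x / r (N + j)\<bar> \<le> \<bar>x\<bar> * (B (j + N) / b 0)"
      proof (intro always_eventually allI)
        fix j
        have "\<bar>x\<bar> * (1 / r (j + N)) \<le> \<bar>x\<bar> * (B (j + N) / b 0)" by (intro mult_left_mono inv_r) auto
        then show "\<bar>x / r (N + j)\<bar> \<le> \<bar>x\<bar> * (B (j + N) / b 0)" using r[of "N + j"] by (simp add: add.commute abs_divide)
      qed
    qed auto
    ultimately have "(\<lambda>j. x / r (N + j) + (\<Sum>i. c i j)) \<longlonglongrightarrow> 0 + Z_var q Y \<omega>"
      by (intro tendsto_add) auto
    then show ?thesis by (simp add: T_eq)
  qed
  have h: "continuous_on UNIV (\<lambda>d. \<bar>d / r n\<bar> powr p)" for n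
    using p r[of n] by (intro continuous_on_powr' continuous_intros) auto
  have Tm [measurable]: "T N x j \<in> borel_measurable M" for N x j
    unfolding T_def[abs_def]
    by (intro borel_measurable_divide borel_measurable_add borel_measurable_sum borel_measurable_times Ym
        borel_measurable_const) auto
  have Zm [measurable]: "Z_var q Y \<in> borel_measurable M"
    unfolding Z_var_def[abs_def]
    by (intro borel_measurable_times borel_measurable_suminf Ym borel_measurable_const) auto
  have "has_dyadic_variation (Phi g q) (signed_tent_series (coeff_a g q) \<sigma>)
    (\<lambda>t. expectation (\<lambda>\<omega>. \<bar>Z_var q Y \<omega>\<bar> powr p) * t)"
  proof (rule has_dyadic_variation_signed_tent_seriesI[OF g _ q(2) p_def s _ r_def])
    show "summable (\<lambda>m. \<bar>coeff_a g q m\<bar>)"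
      using summable_tent_coefficients[OF g q(2), of K] K by (simp add: coeff_a_def[abs_def] K_def)
    have "\<forall>\<^sub>F n in sequentially. W / 2 \<le> real n"
      using filterlim_real_sequentially unfolding filterlim_at_top by blast
    then have "\<forall>\<^sub>F n in sequentially. (\<Sum>m<n. \<bar>b m\<bar>) \<le> 2 * real n * r n"
    proof eventually_elim
      case (elim n)
      have "(\<Sum>m<n. \<bar>b m\<bar>) / r n \<le> W" using block_le[of 0 n] by simp
      also have "W \<le> 2 * real n" using elim by simp
      finally show ?case using r[of n] by (simp add: divide_le_eq)
    qed
    then show "\<forall>\<^sub>F n in sequentially. (\<Sum>m<n. \<bar>2 ^ m * coeff_a g q m\<bar>) \<le> 2 * real n * r n"
      by (simp add: b_def)
    show "\<exists>B. \<forall>\<^sub>F j in sequentially.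
      sign_mean (\<lambda>m. 2 ^ (N + m) * coeff_a g q (N + m)) j (\<lambda>d. \<bar>d / r (N + j)\<bar> powr (2 * p)) x \<le> B" for N x
      unfolding b_def[symmetric]
    proof (intro exI always_eventually allI sign_mean_le)
      fix j d assume "\<bar>d - x\<bar> \<le> (\<Sum>m<j. \<bar>b (N + m)\<bar>)"
      from value_le[OF this] show "\<bar>d / r (N + j)\<bar> powr (2 * p) \<le> (\<bar>x\<bar> * (B 0 / b 0) + W) powr (2 * p)"
        using p by (intro powr_mono2) auto
    qed
    show "(\<lambda>j. sign_mean (\<lambda>m. 2 ^ (N + m) * coeff_a g q (N + m)) j (\<lambda>d. \<bar>d / r (N + j)\<bar> powr p) x)
      \<longlonglongrightarrow> expectation (\<lambda>\<omega>. \<bar>Z_var q Y \<omega>\<bar> powr p)" for N x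
    proof -
      have "(\<lambda>j. expectation (\<lambda>\<omega>. \<bar>T N x j \<omega>\<bar> powr p)) \<longlonglongrightarrow> expectation (\<lambda>\<omega>. \<bar>Z_var q Y \<omega>\<bar> powr p)"
      proof (rule integral_dominated_convergence[where w = "\<lambda>_. (\<bar>x\<bar> * (B 0 / b 0) + W) powr p"])
        show "AE \<omega> in M. (\<lambda>j. \<bar>T N x j \<omega>\<bar> powr p) \<longlonglongrightarrow> \<bar>Z_var q Y \<omega>\<bar> powr p"
        proof (rule AE_I2)
          fix \<omega> assume "\<omega> \<in> space M"
          from tendsto_rabs[OF T_lim[OF this]]
          show "(\<lambda>j. \<bar>T N x j \<omega>\<bar> powr p) \<longlonglongrightarrow> \<bar>Z_var q Y \<omega>\<bar> powr p"
            by (rule tendsto_powr') (use p in auto)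
        qed
        show "AE \<omega> in M. norm (\<bar>T N x j \<omega>\<bar> powr p) \<le> (\<bar>x\<bar> * (B 0 / b 0) + W) powr p" for j
        proof (rule AE_I2)
          fix \<omega> assume \<omega>: "\<omega> \<in> space M"
          have "\<bar>\<Sum>m<j. b (N + m) * Y (j - m) \<omega>\<bar> \<le> (\<Sum>m<j. \<bar>b (N + m)\<bar>)"
          proof (rule order_trans[OF sum_abs sum_mono])
            fix m assume "m \<in> {..<j}"
            then have "Y (j - m) \<omega> \<in> {-1, 1}" using \<omega> by (intro Yv) auto
            then show "\<bar>b (N + m) * Y (j - m) \<omega>\<bar> \<le> \<bar>b (N + m)\<bar>" by (auto simp: abs_mult)
          qed
          then have "\<bar>T N x j \<omega>\<bar> \<le> \<bar>x\<bar> * (B 0 / b 0) + W"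
            unfolding T_def by (intro value_le) simp
          then show "norm (\<bar>T N x j \<omega>\<bar> powr p) \<le> (\<bar>x\<bar> * (B 0 / b 0) + W) powr p"
            using p by (auto intro: powr_mono2)
        qed
      qed auto
      moreover have "sign_mean (\<lambda>m. b (N + m)) j (\<lambda>d. \<bar>d / r (N + j)\<bar> powr p) x
          = expectation (\<lambda>\<omega>. \<bar>T N x j \<omega>\<bar> powr p)" for j
        unfolding T_def by (rule sign_mean_eq_expectation[OF indep Y h])
      ultimately show ?thesis unfolding b_def[symmetric] by simp
    qed
  qed (use q in auto)
  then show ?thesis by (simp only: p_def)
qed

section \<open>A central limit theorem for means over random signs\<close>

lemma sign_mean_mono:
  fixes h k :: "real \<Rightarrow> real"
  assumes "\<And>d. h d \<le> k d"
  shows "sign_mean b j h x \<le> sign_mean b j k x"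
  by (induction j arbitrary: b x) (auto simp: assms intro!: add_mono divide_right_mono)

lemma sign_mean_add:
  "sign_mean b j (\<lambda>d. h d + k d) x = sign_mean b j h x + sign_mean b j k x"
  by (induction j arbitrary: b x) (auto simp: scaleR_add_right)

lemma sign_mean_divide:
  fixes h :: "real \<Rightarrow> real"
  shows "sign_mean b j (\<lambda>d. h d / c) x = sign_mean b j h x / c"
  by (induction j arbitrary: b x) (auto simp: add_divide_distrib)

text \<open>The mixed terms cancel between the two signs, so the variances add up.\<close>

lemma sign_mean_square:
  "sign_mean b j (\<lambda>d. (d / c)\<^sup>2) x = (x\<^sup>2 + (\<Sum>m<j. (b m)\<^sup>2)) / c\<^sup>2" for c :: real
proof (induction j arbitrary: b x)
  case (Suc j)
  show ?case
    unfolding sign_mean.simps Suc.IH sum.lessThan_Suc_shift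
    by (simp add: power2_eq_square add_divide_distrib diff_divide_distrib algebra_simps)
qed (simp add: power_divide)

lemma sign_mean_cis:
  "sign_mean b j (\<lambda>d. cis (u * d)) x = of_real (\<Prod>m<j. cos (u * b m)) * cis (u * x)"
proof (induction j arbitrary: b x)
  case (Suc j)
  have "cis (u * (x + b 0)) + cis (u * (x - b 0)) = 2 * of_real (cos (u * b 0)) * cis (u * x)"
    by (auto simp: complex_eq_iff cos_add cos_diff sin_add sin_diff algebra_simps)
  then have "sign_mean b (Suc j) (\<lambda>d. cis (u * d)) x =
      (1 / 2) *\<^sub>R (of_real (\<Prod>m<j. cos (u * b (Suc m))) * (2 * of_real (cos (u * b 0)) * cis (u * x)))"
    by (simp only: sign_mean.simps Suc.IH distrib_left[symmetric])
  then show ?case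
    unfolding prod.lessThan_Suc_shift by (simp add: scaleR_conv_of_real mult_ac)
qed simp

text \<open>The law behind \<open>sign_mean\<close>. No random signs are given in the case
  \<open>q = 0\<close>, and Levy's continuity theorem needs actual measures.\<close>

fun sign_pmf :: "(nat \<Rightarrow> real) \<Rightarrow> nat \<Rightarrow> real \<Rightarrow> real pmf" where
  "sign_pmf b 0 x = return_pmf x"
| "sign_pmf b (Suc j) x =
     bernoulli_pmf (1 / 2) \<bind> (\<lambda>s. sign_pmf (\<lambda>m. b (Suc m)) j (if s then x + b 0 else x - b 0))"

lemma finite_set_sign_pmf: "finite (set_pmf (sign_pmf b j x))"
  by (induction j arbitrary: b x) auto

lemma expectation_sign_pmf:
  fixes h :: "real \<Rightarrow> 'b::{banach, second_countable_topology}"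
  shows "measure_pmf.expectation (sign_pmf b j x) h = sign_mean b j h x"
proof (induction j arbitrary: b x)
  case (Suc j)
  show ?case
    by (simp add: pmf_expectation_bind[where A = UNIV] finite_set_sign_pmf Suc.IH UNIV_bool scaleR_add_right)
qed simp

text \<open>Both functions are \<open>1 - y\<^sup>2 / 2\<close> up to errors of third order, with
  constants 1/6 and 1/4.\<close>

lemma abs_cos_minus_exp_le:
  fixes y :: real assumes "\<bar>y\<bar> \<le> 1"
  shows "\<bar>cos y - exp (- (y\<^sup>2 / 2))\<bar> \<le> \<bar>y\<bar> ^ 3"
proof -
  have "\<bar>Re (iexp y - (\<Sum>k\<le>2. (\<i> * y)^k / fact k))\<bar> \<le> \<bar>y\<bar> ^ Suc 2 / fact (Suc 2)"
    by (rule order_trans[OF abs_Re_le_cmod iexp_approx1])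
  moreover have "Re (iexp y - (\<Sum>k\<le>2. (\<i> * y)^k / fact k)) = cos y - (1 - y\<^sup>2 / 2)"
    by (simp add: cis_conv_exp[symmetric] numeral_2_eq_2 Re_divide power2_eq_square)
  ultimately have c: "\<bar>cos y - (1 - y\<^sup>2 / 2)\<bar> \<le> \<bar>y\<bar> ^ 3 / 6"
    by (simp add: fact_numeral numeral_3_eq_3)
  define v where "v = y\<^sup>2 / 2"
  have v: "v \<ge> 0" by (simp add: v_def)
  have "1 - v \<le> exp (- v)" using exp_ge_add_one_self[of "-v"] by linarith
  moreover have "exp (- v) \<le> 1 - v + v\<^sup>2"
  proof -
    \<comment> \<open>The product equals \<open>1 + v ^ 3\<close>.\<close>
    have "1 \<le> (1 + v) * (1 - v + v\<^sup>2)" using v by (simp add: algebra_simps power2_eq_square)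
    also have "\<dots> \<le> exp v * (1 - v + v\<^sup>2)"
    proof (rule mult_right_mono)
      show "1 + v \<le> exp v" by (rule exp_ge_add_one_self)
      have "1 - v + v\<^sup>2 = (v - 1/2)\<^sup>2 + 3/4" by (simp add: power2_eq_square algebra_simps)
      then show "0 \<le> 1 - v + v\<^sup>2" by simp
    qed
    finally show ?thesis by (simp add: exp_minus field_simps)
  qed
  ultimately have "\<bar>exp (- v) - (1 - v)\<bar> \<le> v\<^sup>2" by linarith
  also have "v\<^sup>2 = \<bar>y\<bar> ^ 4 / 4" by (simp add: v_def power_divide power_abs)
  also have "\<bar>y\<bar> ^ 4 \<le> \<bar>y\<bar> ^ 3" using assms by (intro power_decreasing) auto
  finally have "\<bar>exp (- (y\<^sup>2 / 2)) - (1 - y\<^sup>2 / 2)\<bar> \<le> \<bar>y\<bar> ^ 3 / 4" by (simp add: v_def)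
  moreover have "0 \<le> \<bar>y\<bar> ^ 3" by simp
  ultimately show ?thesis using c by linarith
qed

lemma sum_lessThan_add:
  fixes f :: "nat \<Rightarrow> real" shows "(\<Sum>m<N + j. f m) = (\<Sum>m<N. f m) + (\<Sum>m<j. f (N + m))"
  by (induction j) auto

text \<open>Uniform integrability by second moments, to pass from bounded continuous functions to
  the absolute value.\<close>

lemma truncated_abs_le:
  fixes w :: real assumes "K > 0"
  shows "\<bar>w\<bar> \<le> min \<bar>w\<bar> K + w\<^sup>2 / K"
proof (cases "\<bar>w\<bar> \<le> K")
  case False
  then have "\<bar>w\<bar> * K \<le> \<bar>w\<bar> * \<bar>w\<bar>" by (intro mult_left_mono) auto
  then have "\<bar>w\<bar> \<le> w\<^sup>2 / K" using assms by (simp add: le_divide_eq power2_eq_square)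
  then show ?thesis by (rule add_increasing[rotated]) (use assms in simp)
qed (use assms in simp)

text \<open>For weighted fair signs, \<open>variance\<close> and \<open>negligible\<close> together
  imply Lindeberg's condition. Divergence of \<open>r\<close> wipes out the starting point and any
  finite number of initial weights, so that all limits are the same for every \<open>N\<close> and
  \<open>x\<close>.\<close>

locale sign_clt =
  fixes b r :: "nat \<Rightarrow> real"
  assumes r_pos: "\<And>n. r n > 0"
    and r_lim: "filterlim r at_top sequentially"
    and variance: "(\<lambda>n. (\<Sum>m<n. (b m)\<^sup>2) / (r n)\<^sup>2) \<longlonglongrightarrow> 1"
    and negligible: "\<And>e. e > 0 \<Longrightarrow> \<forall>\<^sub>F n in sequentially. \<forall>m<n. \<bar>b m\<bar> \<le> e * r n"
begin

lemma r_inverse: "(\<lambda>j. x / r (N + j)) \<longlonglongrightarrow> 0"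
  using LIMSEQ_ignore_initial_segment[OF tendsto_divide_0[OF tendsto_const filterlim_at_top_imp_at_infinity[OF r_lim]], of x N]
  by (simp add: add.commute)

lemma block_variance: "(\<lambda>j. (\<Sum>m<j. (b (N + m))\<^sup>2) / (r (N + j))\<^sup>2) \<longlonglongrightarrow> 1"
proof -
  define c where "c = (\<Sum>m<N. (b m)\<^sup>2)"
  \<comment> \<open>The variance \<open>c\<close> of the dropped initial weights is split into
    square roots so that \<open>r_inverse\<close> applies to each factor.\<close>
  have "(\<lambda>j. (\<Sum>m<N + j. (b m)\<^sup>2) / (r (N + j))\<^sup>2 - sqrt c / r (N + j) * (sqrt c / r (N + j))) \<longlonglongrightarrow> 1 - 0 * 0"
    using LIMSEQ_ignore_initial_segment[OF variance, of N]
    by (intro tendsto_diff tendsto_mult r_inverse) (simp add: add.commute)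
  moreover have "sqrt c / r (N + j) * (sqrt c / r (N + j)) = c / (r (N + j))\<^sup>2" for j
    by (simp add: c_def sum_nonneg power2_eq_square)
  ultimately show ?thesis
    by (simp add: sum_lessThan_add c_def[symmetric] add_divide_distrib)
qed

lemma second_moment: "(\<lambda>j. sign_mean (\<lambda>m. b (N + m)) j (\<lambda>d. (d / r (N + j))\<^sup>2) x) \<longlonglongrightarrow> 1"
proof -
  have "(\<lambda>j. (x / r (N + j))\<^sup>2 + (\<Sum>m<j. (b (N + m))\<^sup>2) / (r (N + j))\<^sup>2) \<longlonglongrightarrow> 0\<^sup>2 + 1"
    by (intro tendsto_intros r_inverse block_variance)
  then show ?thesis unfolding sign_mean_square by (simp add: add_divide_distrib power_divide)
qed

text \<open>All factors have modulus at most 1, so replacing each cosine by a Gaussian costs at most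
  the sum of the single errors. By the cubic bound this is at most the largest
  \<open>\<bar>y j m\<bar>\<close>, which vanishes, times the sum of squares, which
  converges.\<close>

lemma prod_cos_tendsto:
  "(\<lambda>j. \<Prod>m<j. cos (u / r (N + j) * b (N + m))) \<longlonglongrightarrow> exp (- (u\<^sup>2 / 2))"
proof -
  define y where "y j m = u / r (N + j) * b (N + m)" for j m
  define s where "s j = (\<Sum>m<j. (b (N + m))\<^sup>2) / (r (N + j))\<^sup>2" for j
  have s: "s \<longlonglongrightarrow> 1" unfolding s_def by (rule block_variance)
  have ysum: "(\<Sum>m<j. (y j m)\<^sup>2) = u\<^sup>2 * s j" for j
    by (simp add: y_def s_def sum_distrib_left sum_divide_distrib power_mult_distrib power_divide)
  have "(\<lambda>j. (\<Prod>m<j. cos (y j m)) - (\<Prod>m<j. exp (- ((y j m)\<^sup>2 / 2)))) \<longlonglongrightarrow> 0"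
  proof (rule tendstoI)
    fix e :: real assume e: "e > 0"
    \<comment> \<open>Once \<open>s j < 2\<close>, the error is at most
      \<open>d * (u\<^sup>2 * 2)\<close>; the added 1 covers \<open>u = 0\<close> and leaves room
      for a strict inequality. The cap 1 is the range of
      \<open>abs_cos_minus_exp_le\<close>.\<close>
    define d where "d = min 1 (e / (2 * u\<^sup>2 + 1))"
    have u0: "2 * u\<^sup>2 + 1 > 0" by (simp add: add_nonneg_pos)
    then have d: "d > 0" "d \<le> 1" using e by (auto simp: d_def)
    have "d \<le> e / (2 * u\<^sup>2 + 1)" by (simp add: d_def)
    then have de: "d * (2 * u\<^sup>2 + 1) \<le> e" using u0 by (simp only: le_divide_eq if_True)
    define d' where "d' = d / (\<bar>u\<bar> + 1)"
    have d': "d' > 0" "\<bar>u\<bar> * d' \<le> d" using d by (auto simp: d'_def field_simps)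
    have "\<forall>\<^sub>F j in sequentially. \<forall>m<j + N. \<bar>b m\<bar> \<le> d' * r (j + N)"
      using negligible[OF d'(1)] by (subst eventually_sequentially_seg)
    moreover have "\<forall>\<^sub>F j in sequentially. s j < 2" by (rule order_tendstoD(2)[OF s]) simp
    ultimately show "\<forall>\<^sub>F j in sequentially.
        dist ((\<Prod>m<j. cos (y j m)) - (\<Prod>m<j. exp (- ((y j m)\<^sup>2 / 2)))) 0 < e"
    proof eventually_elim
      case (elim j)
      have yd: "\<bar>y j m\<bar> \<le> d" if "m < j" for m
      proof -
        have "\<bar>b (N + m)\<bar> \<le> d' * r (N + j)" using elim that by (simp add: add.commute)
        then have "\<bar>u\<bar> * (\<bar>b (N + m)\<bar> / r (N + j)) \<le> \<bar>u\<bar> * d'"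
          using r_pos[of "N + j"] by (intro mult_left_mono) (auto simp: divide_le_eq)
        then show ?thesis using d' r_pos[of "N + j"] by (simp add: y_def abs_mult)
      qed
      have "\<bar>(\<Prod>m<j. cos (y j m)) - (\<Prod>m<j. exp (- ((y j m)\<^sup>2 / 2)))\<bar>
        \<le> (\<Sum>m<j. \<bar>cos (y j m) - exp (- ((y j m)\<^sup>2 / 2))\<bar>)"
        using norm_prod_diff[of "{..<j}" "\<lambda>m. cos (y j m)" "\<lambda>m. exp (- ((y j m)\<^sup>2 / 2))"] by simp
      also have "\<dots> \<le> (\<Sum>m<j. d * (y j m)\<^sup>2)"
      proof (rule sum_mono)
        fix m assume "m \<in> {..<j}"
        then have ym: "\<bar>y j m\<bar> \<le> d" using yd by simp
        then have "\<bar>cos (y j m) - exp (- ((y j m)\<^sup>2 / 2))\<bar> \<le> \<bar>y j m\<bar> ^ 3"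
          using d by (intro abs_cos_minus_exp_le) simp
        also have "\<dots> = \<bar>y j m\<bar> * (y j m)\<^sup>2" by (simp add: power3_eq_cube power2_eq_square)
        also have "\<dots> \<le> d * (y j m)\<^sup>2" using ym by (intro mult_right_mono) auto
        finally show "\<bar>cos (y j m) - exp (- ((y j m)\<^sup>2 / 2))\<bar> \<le> d * (y j m)\<^sup>2" .
      qed
      also have "\<dots> = d * (u\<^sup>2 * s j)" by (simp add: sum_distrib_left[symmetric] ysum)
      also have "\<dots> \<le> d * (u\<^sup>2 * 2)" using elim d by (intro mult_left_mono) auto
      also have "\<dots> < d * (2 * u\<^sup>2 + 1)" using d by simp
      also note de
      finally show ?case by (simp add: dist_real_def)
    qed
  qed
  moreover have "(\<lambda>j. \<Prod>m<j. exp (- ((y j m)\<^sup>2 / 2))) \<longlonglongrightarrow> exp (- (u\<^sup>2 / 2))"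
  proof -
    have "(\<Prod>m<j. exp (- ((y j m)\<^sup>2 / 2))) = exp (- (u\<^sup>2 * s j / 2))" for j
      by (simp add: exp_sum[symmetric] sum_negf sum_divide_distrib[symmetric] ysum)
    moreover have "(\<lambda>j. exp (- (u\<^sup>2 * s j / 2))) \<longlonglongrightarrow> exp (- (u\<^sup>2 * 1 / 2))"
      by (intro tendsto_intros s) auto
    ultimately show ?thesis by simp
  qed
  ultimately have "(\<lambda>j. ((\<Prod>m<j. cos (y j m)) - (\<Prod>m<j. exp (- ((y j m)\<^sup>2 / 2)))) + (\<Prod>m<j. exp (- ((y j m)\<^sup>2 / 2))))
    \<longlonglongrightarrow> 0 + exp (- (u\<^sup>2 / 2))"
    by (rule tendsto_add)
  then show ?thesis by (simp add: y_def)
qed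

lemma bounded_continuous_mean_tendsto:
  fixes h :: "real \<Rightarrow> real"
  assumes h: "\<And>x. isCont h x" "\<And>x. norm (h x) \<le> B"
  shows "(\<lambda>j. sign_mean (\<lambda>m. b (N + m)) j (\<lambda>d. h (d / r (N + j))) x) \<longlonglongrightarrow> integral\<^sup>L std_normal_distribution h"
proof -
  define \<mu> where "\<mu> j = distr (measure_pmf (sign_pmf (\<lambda>m. b (N + m)) j x)) borel (\<lambda>d. d / r (N + j))" for j
  have \<mu>: "real_distribution (\<mu> j)" for j
    unfolding \<mu>_def by (rule prob_space.real_distribution_distr[OF measure_pmf.prob_space_axioms]) simp
  have mean: "integral\<^sup>L (\<mu> j) k = sign_mean (\<lambda>m. b (N + m)) j (\<lambda>d. k (d / r (N + j))) x"
    if "k \<in> borel_measurable borel" for k :: "real \<Rightarrow> 'b::{banach, second_countable_topology}" and j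
    unfolding \<mu>_def using that by (simp add: integral_distr expectation_sign_pmf)
  have "weak_conv_m \<mu> std_normal_distribution"
  proof (rule levy_continuity[OF \<mu>])
    show "real_distribution std_normal_distribution" by (rule real_dist_normal_dist)
    fix u :: real
    have "char (\<mu> j) u = of_real (\<Prod>m<j. cos (u / r (N + j) * b (N + m))) * cis (u * (x / r (N + j)))" for j
    proof -
      have "char (\<mu> j) u = sign_mean (\<lambda>m. b (N + m)) j (\<lambda>d. cis (u / r (N + j) * d)) x"
        unfolding char_def by (subst mean) (auto simp: cis_conv_exp mult_ac)
      then show ?thesis using sign_mean_cis[of "\<lambda>m. b (N + m)" j "u / r (N + j)" x] by simp
    qed
    moreover have "(\<lambda>j. of_real (\<Prod>m<j. cos (u / r (N + j) * b (N + m))) * cis (u * (x / r (N + j))))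
       \<longlonglongrightarrow> of_real (exp (- (u\<^sup>2 / 2))) * cis (u * 0)"
      by (intro tendsto_mult tendsto_of_real prod_cos_tendsto tendsto_cis tendsto_const r_inverse)
    ultimately show "(\<lambda>j. char (\<mu> j) u) \<longlonglongrightarrow> char std_normal_distribution u"
      by (simp add: char_std_normal_distribution)
  qed
  from weak_conv_imp_integral_bdd_continuous_conv[OF \<mu> real_dist_normal_dist this h]
  have "(\<lambda>j. integral\<^sup>L (\<mu> j) h) \<longlonglongrightarrow> integral\<^sup>L std_normal_distribution h" .
  then show ?thesis using h(1)
    by (subst (asm) mean) (auto intro!: borel_measurable_continuous_onI continuous_at_imp_continuous_on)
qed

lemma absolute_mean_tendsto:
  "(\<lambda>j. sign_mean (\<lambda>m. b (N + m)) j (\<lambda>d. \<bar>d / r (N + j)\<bar>) x) \<longlonglongrightarrow> sqrt (2 / pi)"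
proof (rule tendstoI)
  fix e :: real assume e: "e > 0"
  \<comment> \<open>Truncation costs at most \<open>2 / K = e / 3\<close> for the sign mean, whose
    second moment is eventually below 2, and \<open>1 / K = e / 6\<close> for the normal law. The
    remaining \<open>e / 2\<close> is for the weak convergence.\<close>
  define K where "K = 6 / e"
  have K: "K > 0" using e by (simp add: K_def)
  let ?\<nu> = std_normal_distribution
  interpret \<nu>: real_distribution ?\<nu> by (rule real_dist_normal_dist)
  define A where "A j = sign_mean (\<lambda>m. b (N + m)) j (\<lambda>d. \<bar>d / r (N + j)\<bar>) x" for j
  define AK where "AK j = sign_mean (\<lambda>m. b (N + m)) j (\<lambda>d. min \<bar>d / r (N + j)\<bar> K) x" for j
  define A2 where "A2 j = sign_mean (\<lambda>m. b (N + m)) j (\<lambda>d. (d / r (N + j))\<^sup>2) x" for j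
  have A: "AK j \<le> A j" "A j \<le> AK j + A2 j / K" for j
  proof -
    show "AK j \<le> A j" unfolding AK_def A_def by (rule sign_mean_mono) simp
    have "A j \<le> sign_mean (\<lambda>m. b (N + m)) j (\<lambda>d. min \<bar>d / r (N + j)\<bar> K + (d / r (N + j))\<^sup>2 / K) x"
      unfolding A_def by (rule sign_mean_mono, rule truncated_abs_le[OF K])
    then show "A j \<le> AK j + A2 j / K" by (simp add: sign_mean_add sign_mean_divide AK_def A2_def)
  qed
  have m1: "integrable ?\<nu> (\<lambda>w. \<bar>w\<bar>)" "(LINT w|?\<nu>. \<bar>w\<bar>) = sqrt (2 / pi)"
    using std_normal_moment_abs_odd[of 0]
    by (auto simp: integrable_density integral_density has_bochner_integral_iff)
  have m2: "integrable ?\<nu> (\<lambda>w. w\<^sup>2)" "(LINT w|?\<nu>. w\<^sup>2) = 1"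
    using std_normal_moment_even[of 1]
    by (auto simp: integrable_density integral_density has_bochner_integral_iff)
  define I where "I = (LINT w|?\<nu>. min \<bar>w\<bar> K)"
  have mK: "integrable ?\<nu> (\<lambda>w. min \<bar>w\<bar> K)"
    using K by (intro \<nu>.integrable_const_bound[of _ K]) auto
  have I: "I \<le> sqrt (2 / pi)" "sqrt (2 / pi) \<le> I + 1 / K"
  proof -
    show "I \<le> sqrt (2 / pi)"
      unfolding I_def m1(2)[symmetric] by (rule integral_mono[OF mK m1(1)]) simp
    have "(LINT w|?\<nu>. \<bar>w\<bar>) \<le> (LINT w|?\<nu>. min \<bar>w\<bar> K + w\<^sup>2 / K)"
      using mK m1 m2 by (intro integral_mono truncated_abs_le K) auto
    then show "sqrt (2 / pi) \<le> I + 1 / K" using mK m2 m1 by (simp add: I_def)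
  qed
  have "AK \<longlonglongrightarrow> I"
    unfolding AK_def I_def
    by (rule bounded_continuous_mean_tendsto[where B = K]) (use K in \<open>auto intro!: continuous_intros\<close>)
  then have "\<forall>\<^sub>F j in sequentially. dist (AK j) I < e / 2" using e by (intro tendstoD) auto
  moreover have "\<forall>\<^sub>F j in sequentially. A2 j < 2"
    unfolding A2_def by (rule order_tendstoD(2)[OF second_moment]) simp
  ultimately show "\<forall>\<^sub>F j in sequentially. dist (sign_mean (\<lambda>m. b (N + m)) j (\<lambda>d. \<bar>d / r (N + j)\<bar>) x) (sqrt (2 / pi)) < e"
    unfolding A_def[symmetric]
  proof eventually_elim
    case (elim j)
    have "A2 j / K \<le> 2 / K" using elim K by (intro divide_right_mono) auto
    moreover have "2 / K = e / 3" "1 / K = e / 6" using e by (auto simp: K_def)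
    ultimately show ?case using A[of j] I elim unfolding dist_real_def by linarith
  qed
qed

end

section \<open>The case of \<open>q = 0\<close>\<close>

lemma regularly_varying_set_integrable:
  assumes g: "regularly_varying g \<rho>" and A: "A \<in> sets lebesgue" "A \<subseteq> {0..c}"
  shows "set_integrable lebesgue A g"
proof -
  have "g \<in> borel_measurable (lebesgue_on {0..})" using g by (simp add: regularly_varying_def)
  then have m: "(\<lambda>t. if t \<in> {0..} then g t else 0) \<in> borel_measurable lebesgue"
    by (subst borel_measurable_if) auto
  have "bounded (g ` {0..c})" using g by (simp add: regularly_varying_def)
  then obtain B where B: "\<forall>t\<in>{0..c}. \<bar>g t\<bar> \<le> B" by (auto simp: bounded_iff)
  have "emeasure lebesgue A \<le> emeasure lebesgue {0..c}" using A by (intro emeasure_mono) auto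
  also have "\<dots> < \<infinity>" by (simp add: emeasure_lborel_Icc_eq)
  finally have "integrable lebesgue (\<lambda>t. indicator A t *\<^sub>R (if t \<in> {0..} then g t else 0))"
    using A B by (intro integrableI_bounded_set_indicator[where B = B] m AE_I2) auto
  also have "(\<lambda>t. indicator A t *\<^sub>R (if t \<in> {0..} then g t else 0)) = (\<lambda>t. indicator A t *\<^sub>R g t)"
    using A by (auto simp: indicator_def fun_eq_iff)
  finally show ?thesis by (simp add: set_integrable_def)
qed

lemma set_integral_between:
  fixes f :: "real \<Rightarrow> real"
  assumes f: "set_integrable lebesgue {real n<..real n + 1} f"
    and lo: "\<And>t. t \<in> {real n<..real n + 1} \<Longrightarrow> l \<le> f t" and hi: "\<And>t. t \<in> {real n<..real n + 1} \<Longrightarrow> f t \<le> h"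
  shows "l \<le> (LINT t:{real n<..real n + 1}|lebesgue. f t)" "(LINT t:{real n<..real n + 1}|lebesgue. f t) \<le> h"
proof -
  have c: "set_integrable lebesgue {real n<..real n + 1} (\<lambda>_. c)" "(LINT t:{real n<..real n + 1}|lebesgue. c) = c" for c :: real
    by (simp_all add: set_integrable_def set_lebesgue_integral_def)
  show "l \<le> (LINT t:{real n<..real n + 1}|lebesgue. f t)"
    using set_integral_mono[OF c(1)[of l] f lo] by (simp add: c)
  show "(LINT t:{real n<..real n + 1}|lebesgue. f t) \<le> h"
    using set_integral_mono[OF f c(1)[of h] hi] by (simp add: c)
qed

locale regularly_varying_derivative =
  fixes g g' :: "real \<Rightarrow> real" and \<rho> \<rho>' :: real
  assumes g: "regularly_varying g \<rho>" and g': "regularly_varying g' \<rho>'"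
    and g_top: "filterlim g at_top at_top"
    and ftc: "\<And>x. x \<ge> 0 \<Longrightarrow> g x = g 0 + (LINT t:{0..x}|lebesgue. g' t)"
begin

lemma pos: "x \<ge> 0 \<Longrightarrow> g x > 0" "x \<ge> 0 \<Longrightarrow> g' x > 0"
  using g g' by (simp_all add: regularly_varying_def)

lemma increment: "g (real (Suc n)) - g (real n) = (LINT t:{real n<..real n + 1}|lebesgue. g' t)"
proof -
  have "{0..real (Suc n)} = {0..real n} \<union> {real n<..real n + 1}" by auto
  then have "(LINT t:{0..real (Suc n)}|lebesgue. g' t)
    = (LINT t:{0..real n}|lebesgue. g' t) + (LINT t:{real n<..real n + 1}|lebesgue. g' t)"
    by (simp only:) (intro set_integral_Un regularly_varying_set_integrable[OF g', where c = "real n + 1"]; auto)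
  then show ?thesis using ftc[of "real n"] ftc[of "real (Suc n)"] by simp
qed

text \<open>For large \<open>n\<close> the function \<open>g'\<close> varies over
  \<open>[n, n + 1]\<close> by a factor of at most \<open>1 + e\<close>, so its value at
  \<open>n\<close> is close to its integral. This stands in for Karamata's theorem on integrals of
  regularly varying functions.\<close>

lemma increment_near_derivative:
  assumes e: "e > 0"
  shows "\<forall>\<^sub>F n in sequentially.
    \<bar>g' (real n) - (g (real (Suc n)) - g (real n))\<bar> \<le> e * (g (real (Suc n)) - g (real n))"
proof -
  have "ln (1 + e) > 0" using e by simp
  from regularly_varying_ln_shift[OF g' this] show ?thesis
  proof eventually_elim
    case (elim n)
    define I where "I = g (real (Suc n)) - g (real n)"
    have int: "set_integrable lebesgue {real n<..real n + 1} g'"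
      by (rule regularly_varying_set_integrable[OF g', where c = "real n + 1"]) auto
    have near: "g' (real n) / (1 + e) \<le> g' t \<and> g' t \<le> g' (real n) * (1 + e)" if "t \<in> {real n<..real n + 1}" for t
    proof -
      have p: "g' t > 0" "g' (real n) > 0" using that by (auto intro!: pos)
      have "\<bar>ln (g' t) - ln (g' (real n))\<bar> < ln (1 + e)"
        using elim[rule_format, of "t - real n"] that by simp
      then have "ln (g' (real n)) \<le> ln (g' t) + ln (1 + e)" "ln (g' t) \<le> ln (g' (real n)) + ln (1 + e)" by linarith+
      then have "ln (g' (real n)) \<le> ln (g' t * (1 + e))" "ln (g' t) \<le> ln (g' (real n) * (1 + e))"
        using p e by (simp_all add: ln_mult)
      then show ?thesis using p e by (simp add: divide_le_eq)
    qed
    have "g' (real n) / (1 + e) \<le> I" "I \<le> g' (real n) * (1 + e)"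
      unfolding I_def increment by (rule set_integral_between[OF int]; use near in blast)+
    moreover from this have "g' (real n) \<le> I * (1 + e)" "I / (1 + e) \<le> g' (real n)"
      using e by (simp_all add: divide_le_eq)
    moreover have "I - I / (1 + e) \<le> e * I"
    proof -
      have "0 < g' (real n) / (1 + e)" using pos(2)[of "real n"] e by simp
      then have "I > 0" using \<open>g' (real n) / (1 + e) \<le> I\<close> by (rule less_le_trans)
      then have "I * (1 + e) - I \<le> e * I * (1 + e)" using e by (simp add: algebra_simps)
      then have "(I * (1 + e) - I) / (1 + e) \<le> e * I" using e by (simp add: divide_le_eq)
      then show ?thesis using e by (simp add: diff_divide_distrib)
    qed
    ultimately show ?case unfolding I_def[symmetric] by (simp add: abs_le_iff algebra_simps)
  qed
qed

lemma mono_nat: "m \<le> n \<Longrightarrow> g (real m) \<le> g (real n)"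
proof (induction n rule: dec_induct)
  case (step n)
  have int: "set_integrable lebesgue {real n<..real n + 1} g'"
    by (rule regularly_varying_set_integrable[OF g', where c = "real n + 1"]) auto
  have "0 \<le> (LINT t:{real n<..real n + 1}|lebesgue. g' t)"
    unfolding set_lebesgue_integral_def
    by (rule Bochner_Integration.integral_nonneg) (auto simp: indicator_def intro!: less_imp_le pos)
  then show ?case using step.IH increment[of n] by simp
qed simp

lemma g_nat_top: "filterlim (\<lambda>n. g (real n)) at_top sequentially"
  by (rule filterlim_compose[OF g_top filterlim_real_sequentially])

text \<open>The increments of \<open>g\<close> telescope, the relative errors from some index on are
  small, and the finitely many other errors are swamped because \<open>g\<close> tends to
  infinity.\<close>

lemma sum_derivative: "(\<lambda>n. (\<Sum>m<n. g' (real m)) / g (real n)) \<longlonglongrightarrow> 1"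
proof (rule tendstoI)
  fix e :: real assume e: "e > 0"
  define I where "I n = g (real (Suc n)) - g (real n)" for n
  have I0: "I n \<ge> 0" for n using mono_nat[of n "Suc n"] by (simp add: I_def)
  have "\<forall>\<^sub>F n in sequentially. \<bar>g' (real n) - I n\<bar> \<le> e / 2 * I n"
    unfolding I_def by (rule increment_near_derivative) (use e in simp)
  then obtain n0 where n0: "\<And>n. n \<ge> n0 \<Longrightarrow> \<bar>g' (real n) - I n\<bar> \<le> e / 2 * I n"
    by (auto simp: eventually_sequentially)
  \<comment> \<open>The summand \<open>g 0\<close> compensates for telescoping to
    \<open>g n - g 0\<close> instead of \<open>g n\<close>.\<close>
  define C where "C = (\<Sum>m<n0. \<bar>g' (real m) - I m\<bar>) + g 0"
  have "\<forall>\<^sub>F n in sequentially. 2 * C / e < g (real n)"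
    using g_nat_top by (simp add: filterlim_at_top_dense)
  then show "\<forall>\<^sub>F n in sequentially. dist ((\<Sum>m<n. g' (real m)) / g (real n)) 1 < e"
  proof eventually_elim
    case (elim n)
    have "\<bar>(\<Sum>m<n. g' (real m)) - (\<Sum>m<n. I m)\<bar> \<le> (\<Sum>m<n. \<bar>g' (real m) - I m\<bar>)"
      unfolding sum_subtractf[symmetric] by (rule sum_abs)
    also have "\<dots> \<le> (\<Sum>m<n. (if m < n0 then \<bar>g' (real m) - I m\<bar> else 0) + e / 2 * I m)"
      using n0 I0 e by (intro sum_mono) (auto simp: not_less)
    also have "\<dots> = (\<Sum>m\<in>{..<n} \<inter> {..<n0}. \<bar>g' (real m) - I m\<bar>) + e / 2 * (\<Sum>m<n. I m)"
      by (simp add: sum.distrib sum_distrib_left sum.inter_restrict lessThan_def)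
    also have "(\<Sum>m\<in>{..<n} \<inter> {..<n0}. \<bar>g' (real m) - I m\<bar>) \<le> C - g 0"
      unfolding C_def by (simp, rule sum_mono2) auto
    also have I_sum: "(\<Sum>m<n. I m) = g (real n) - g 0"
      unfolding I_def by (subst sum_lessThan_telescope[of "\<lambda>m. g (real m)"]) simp
    finally have "\<bar>(\<Sum>m<n. g' (real m)) - g (real n)\<bar> \<le> C - g 0 + e / 2 * (g (real n) - g 0) + g 0"
      using pos(1)[of 0] by linarith
    also have "\<dots> \<le> C + e / 2 * g (real n)" using e pos(1)[of 0] by (simp add: algebra_simps)
    also have "\<dots> < e * g (real n)" using elim e by (simp add: field_simps)
    finally have "\<bar>(\<Sum>m<n. g' (real m)) - g (real n)\<bar> / g (real n) < e"
      using pos(1)[of "real n"] by (simp add: divide_less_eq)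
    moreover have "(\<Sum>m<n. g' (real m)) / g (real n) - 1 = ((\<Sum>m<n. g' (real m)) - g (real n)) / g (real n)"
      using pos(1)[of "real n"] by (simp add: diff_divide_distrib)
    ultimately show ?case using pos(1)[of "real n"] by (simp add: dist_real_def abs_divide)
  qed
qed

text \<open>Up to a factor 2, \<open>g' n\<close> is at most the increment of \<open>g\<close>,
  which is \<open>o(g n)\<close> because \<open>ln g\<close> has vanishing increments. Monotonicity
  of \<open>g\<close> carries the bound from index \<open>m\<close> to \<open>n\<close>, and
  divergence of \<open>g\<close> takes care of small \<open>m\<close>.\<close>

lemma derivative_negligible:
  assumes e: "e > 0"
  shows "\<forall>\<^sub>F n in sequentially. \<forall>m<n. g' (real m) \<le> e * g (real n)"
proof -
  have "(\<lambda>n. exp (ln (g (real (Suc n))) - ln (g (real n)))) \<longlonglongrightarrow> exp 0"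
    by (intro tendsto_exp regularly_varying_ln_Suc[OF g])
  then have "\<forall>\<^sub>F n in sequentially. exp (ln (g (real (Suc n))) - ln (g (real n))) < 1 + e / 2"
    using e by (intro order_tendstoD(2)) auto
  \<comment> \<open>The relative error 1 bounds \<open>g' n\<close> by twice the increment, which is
    why the increment itself was compared with \<open>e / 2\<close>.\<close>
  moreover have "\<forall>\<^sub>F n in sequentially.
    \<bar>g' (real n) - (g (real (Suc n)) - g (real n))\<bar> \<le> 1 * (g (real (Suc n)) - g (real n))"
    by (rule increment_near_derivative) simp
  ultimately have "\<forall>\<^sub>F n in sequentially. g' (real n) \<le> e * g (real n)"
  proof eventually_elim
    case (elim n)
    have p: "g (real n) > 0" "g (real (Suc n)) > 0" by (auto intro: pos)
    then have "g (real (Suc n)) / g (real n) < 1 + e / 2" using elim(1) by (simp add: exp_diff)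
    then have "g (real (Suc n)) - g (real n) \<le> e / 2 * g (real n)" using p by (simp add: field_simps)
    moreover have "g' (real n) \<le> 2 * (g (real (Suc n)) - g (real n))"
      using order_trans[OF abs_ge_self elim(2)] by (simp add: algebra_simps)
    ultimately show ?case by simp
  qed
  then obtain n0 where n0: "\<And>n. n \<ge> n0 \<Longrightarrow> g' (real n) \<le> e * g (real n)"
    by (auto simp: eventually_sequentially)
  have "\<forall>\<^sub>F n in sequentially. (\<Sum>m<n0. g' (real m)) / e \<le> g (real n)"
    using g_nat_top by (simp add: filterlim_at_top)
  then show ?thesis
  proof (eventually_elim, intro allI impI)
    fix n m assume n: "(\<Sum>m<n0. g' (real m)) / e \<le> g (real n)" and m: "m < n"
    show "g' (real m) \<le> e * g (real n)"
    proof (cases "m < n0")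
      case True
      have "g' (real m) \<le> (\<Sum>m<n0. g' (real m))"
        using True by (intro member_le_sum) (auto intro!: less_imp_le[OF pos(2)])
      also have "\<dots> \<le> e * g (real n)" using n e by (simp add: divide_le_eq mult.commute)
      finally show ?thesis .
    next
      case False
      then have "g' (real m) \<le> e * g (real m)" by (intro n0) simp
      also have "\<dots> \<le> e * g (real n)" using e m by (intro mult_left_mono mono_nat) auto
      finally show ?thesis .
    qed
  qed
qed

lemma sign_clt: "sign_clt (\<lambda>n. sqrt (g' (real n))) (\<lambda>n. sqrt (g (real n)))"
proof
  show "0 < sqrt (g (real n))" for n by (simp add: pos)
  show "filterlim (\<lambda>n. sqrt (g (real n))) at_top sequentially"
    by (rule filterlim_compose[OF sqrt_at_top g_nat_top])
  show "(\<lambda>n. (\<Sum>m<n. (sqrt (g' (real m)))\<^sup>2) / (sqrt (g (real n)))\<^sup>2) \<longlonglongrightarrow> 1"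
    using sum_derivative by (simp add: less_imp_le pos)
  fix e :: real assume e: "e > 0"
  then have "e\<^sup>2 > 0" by simp
  from derivative_negligible[OF this]
  show "\<forall>\<^sub>F n in sequentially. \<forall>m<n. \<bar>sqrt (g' (real m))\<bar> \<le> e * sqrt (g (real n))"
  proof (eventually_elim, intro allI impI)
    fix n m assume "\<forall>m<n. g' (real m) \<le> e\<^sup>2 * g (real n)" "m < n"
    then have "sqrt (g' (real m)) \<le> sqrt (e\<^sup>2 * g (real n))" by simp
    also have "\<dots> = e * sqrt (g (real n))" using e by (simp add: real_sqrt_mult)
    finally show "\<bar>sqrt (g' (real m))\<bar> \<le> e * sqrt (g (real n))" by (simp add: less_imp_le pos)
  qed
qed

lemma has_dyadic_variation_coeff_b:
  assumes s: "\<And>m. dyadic_sign m (\<sigma> m)"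
  shows "has_dyadic_variation (Phi g 0) (signed_tent_series (coeff_b g') \<sigma>) (\<lambda>t. sqrt (2 / pi) * t)"
proof -
  define r where "r n = sqrt (g (real n))" for n
  define b where "b n = sqrt (g' (real n))" for n
  interpret clt: sign_clt b r unfolding b_def r_def by (rule sign_clt)
  have b_eq: "2 ^ n * coeff_b g' n = b n" for n
    by (simp add: coeff_b_def b_def powr_minus powr_realpow)
  show ?thesis
  proof (rule has_dyadic_variation_signed_tent_seriesI[OF g, where q = 0 and p = 1 and r = r])
    show "summable (\<lambda>m. \<bar>coeff_b g' m\<bar>)"
      using summable_tent_coefficients[OF g', of 0 1] by (simp add: coeff_b_def[abs_def])
    \<comment> \<open>Unlike for positive \<open>q\<close>, the sum of the weights need not be of
      order \<open>r n\<close>; bounding each of the \<open>n\<close> weights by \<open>r n\<close>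
      is enough.\<close>
    show "\<forall>\<^sub>F n in sequentially. (\<Sum>m<n. \<bar>2 ^ m * coeff_b g' m\<bar>) \<le> 2 * real n * r n"
      unfolding b_eq using clt.negligible[of 1, simplified]
    proof eventually_elim
      case (elim n)
      have "(\<Sum>m<n. \<bar>b m\<bar>) \<le> (\<Sum>m<n. r n)" using elim by (intro sum_mono) auto
      also have "\<dots> \<le> 2 * real n * r n" using clt.r_pos[of n] by simp
      finally show ?case .
    qed
    fix N x
    show "(\<lambda>j. sign_mean (\<lambda>m. 2 ^ (N + m) * coeff_b g' (N + m)) j (\<lambda>d. \<bar>d / r (N + j)\<bar> powr 1) x) \<longlonglongrightarrow> sqrt (2 / pi)"
      unfolding b_eq using clt.absolute_mean_tendsto[of N x] by simp
    have "\<forall>\<^sub>F j in sequentially. sign_mean (\<lambda>m. b (N + m)) j (\<lambda>d. (d / r (N + j))\<^sup>2) x < 2"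
      by (rule order_tendstoD(2)[OF clt.second_moment]) simp
    then show "\<exists>B. \<forall>\<^sub>F j in sequentially.
      sign_mean (\<lambda>m. 2 ^ (N + m) * coeff_b g' (N + m)) j (\<lambda>d. \<bar>d / r (N + j)\<bar> powr (2 * 1)) x \<le> B"
      unfolding b_eq by (intro exI[of _ 2]) (auto elim!: eventually_mono simp: powr_numeral power_divide)
  qed (use s in \<open>auto simp: r_def\<close>)
qed

end

section \<open>The unsigned series as a signed one\<close>

lemma dyadic_sign_one: "dyadic_sign m (\<lambda>_. 1)"
  by (auto simp: dyadic_sign_def constant_on_def)

lemma tent_series_eq_signed: "tent_series \<alpha> = signed_tent_series \<alpha> (\<lambda>_ _. 1)"
  by (simp add: tent_series_def signed_tent_series_def fun_eq_iff)

theorem corollary3p11: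
  fixes g g' :: "real \<Rightarrow> real" and q :: real
    and \<sigma> :: "nat \<Rightarrow> real \<Rightarrow> real"
    and M :: "'a measure" and Y :: "nat \<Rightarrow> 'a \<Rightarrow> real"
  assumes "\<exists>\<rho>. regularly_varying g \<rho>"
    and "0 \<le> q" and "q < 1"
    and "\<And>m. dyadic_sign m (\<sigma> m)"
  shows
    "(0 < q \<and> prob_space M \<and> prob_space.indep_vars M (\<lambda>_. borel) Y {1..} \<and>
        (\<forall>m\<ge>1. symmetric_bernoulli M (Y m)) \<longrightarrow>
        (\<forall>f\<in>{tent_series (coeff_a g q), signed_tent_series (coeff_a g q) \<sigma>}.
           has_dyadic_variation (Phi g q) f
             (\<lambda>t. prob_space.expectation M (\<lambda>\<omega>. \<bar>Z_var q Y \<omega>\<bar> powr (1 / (1 - q))) * t))) \<and>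
     (q = 0 \<and> filterlim g at_top at_top \<and> (\<exists>\<rho>. regularly_varying g' \<rho>) \<and>
        (\<forall>x\<ge>0. g x = g 0 + (LINT t:{0..x}|lebesgue. g' t)) \<longrightarrow>
        (\<forall>f\<in>{tent_series (coeff_b g'), signed_tent_series (coeff_b g') \<sigma>}.
           has_dyadic_variation (Phi g 0) f (\<lambda>t. sqrt (2 / pi) * t)))"
proof -
  obtain \<rho> where g: "regularly_varying g \<rho>" using assms(1) by blast
  show ?thesis
  proof (intro conjI impI; elim conjE)
    assume "0 < q" "prob_space M" and indep: "prob_space.indep_vars M (\<lambda>_. borel) Y {1..}"
      and Y: "\<forall>m\<ge>1. symmetric_bernoulli M (Y m)"
    interpret prob_space M by fact
    have "has_dyadic_variation (Phi g q) (signed_tent_series (coeff_a g q) s)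
        (\<lambda>t. expectation (\<lambda>\<omega>. \<bar>Z_var q Y \<omega>\<bar> powr (1 / (1 - q))) * t)"
      if "\<And>m. dyadic_sign m (s m)" for s
      by (rule has_dyadic_variation_coeff_a[OF g \<open>0 < q\<close> assms(3) that indep]) (use Y in blast)
    then show "\<forall>f\<in>{tent_series (coeff_a g q), signed_tent_series (coeff_a g q) \<sigma>}.
      has_dyadic_variation (Phi g q) f
        (\<lambda>t. expectation (\<lambda>\<omega>. \<bar>Z_var q Y \<omega>\<bar> powr (1 / (1 - q))) * t)"
      using assms(4) dyadic_sign_one by (simp add: tent_series_eq_signed)
  next
    assume "filterlim g at_top at_top" "\<exists>\<rho>. regularly_varying g' \<rho>"
      "\<forall>x\<ge>0. g x = g 0 + (LINT t:{0..x}|lebesgue. g' t)"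
    then obtain \<rho>' where g': "regularly_varying g' \<rho>'" "filterlim g at_top at_top"
      "\<And>x. x \<ge> 0 \<Longrightarrow> g x = g 0 + (LINT t:{0..x}|lebesgue. g' t)" by blast
    interpret regularly_varying_derivative g g' \<rho> \<rho>'
      by (rule regularly_varying_derivative.intro[OF g g'])
    show "\<forall>f\<in>{tent_series (coeff_b g'), signed_tent_series (coeff_b g') \<sigma>}.
      has_dyadic_variation (Phi g 0) f (\<lambda>t. sqrt (2 / pi) * t)"
      using has_dyadic_variation_coeff_b assms(4) dyadic_sign_one by (simp add: tent_series_eq_signed)
  qed
qed

end
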